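(* Let $\mu(n)=n^{\alpha}\log^\beta n$, where either $5/6<\alpha<1$ (and $\beta$ is an arbitrary real number), or $\alpha=1$ and $\beta<0$. Then there exist a finitely generated group $\Gamma$ and a finite generating set $S$ of $\Gamma$ such that $$\gamma_\Gamma^S(n)<\exp(n^{4/5})\ \text{ for infinitely many } n\in\mathbb N,\qquad \gamma_\Gamma^S(n')>\exp(\mu(n'))\ \text{ for infinitely many } n'\in\mathbb N,$$ and $$\gamma_\Gamma^S(m)<\exp\bigl(\mu(9m)\bigr)\quad\text{for all sufficiently large } m\in\mathbb N.$$
   Context: For a group $\Gamma$ with finite symmetric generating set $S$, $\gamma_\Gamma^S(n)$ is the number of elements of $\Gamma$ of word length at most $n$ with respect to $S$. $\log$ is the natural logarithm. *)

theory Defs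
  imports Complex_Main "HOL-Algebra.Generated_Groups"
begin

definition finite_symmetric_generating_set :: "('a, 'b) monoid_scheme \<Rightarrow> 'a set \<Rightarrow> bool" where
  "finite_symmetric_generating_set G S \<longleftrightarrow>
     finite S \<and> S \<subseteq> carrier G \<and> (\<forall>s\<in>S. inv\<^bsub>G\<^esub> s \<in> S) \<and> generate G S = carrier G"

(* Words are over S alone, without formal inverses, so this is the usual word length
   (and the LEAST is over a nonempty set) only when S is a symmetric generating set. *)
definition word_length :: "('a, 'b) monoid_scheme \<Rightarrow> 'a set \<Rightarrow> 'a \<Rightarrow> nat" where
  "word_length G S g =
     (LEAST k. \<exists>w. set w \<subseteq> S \<and> length w = k \<and> foldr (\<otimes>\<^bsub>G\<^esub>) w \<one>\<^bsub>G\<^esub> = g)"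

definition growth :: "('a, 'b) monoid_scheme \<Rightarrow> 'a set \<Rightarrow> nat \<Rightarrow> nat" where
  "growth G S n = card {g \<in> carrier G. word_length G S g \<le> n}"

end

theory Submission
  imports Defs "HOL-Library.Countable" "HOL-Library.Infinite_Set" "HOL-Real_Asymp.Real_Asymp"
begin

text \<open>All groups are quotients of words in four involutions \<open>a, b, c, d\<close> with \<open>bc = d\<close>. Grigorchuk's
  group is the direct limit of the groups acting on \<open>k\<close> levels of the binary tree with sections in
  \<open>Z/2 * (Z/2 x Z/2)\<close>; weighting the letters by 7, 8, 5, 3 gives contraction by 5/6 and hence growth
  below \<open>exp (K n^(159/200))\<close>. Replacing the sections at level \<open>k\<close> by a large finite lamplighter
  2-group \<open>Z/2 wr D\<close> yields finite 2-groups that agree with Grigorchuk's group on any prescribed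
  ball and nevertheless grow at an exponential rate over arbitrarily long ranges.

  Start from Grigorchuk's group. Given the current quotient, wait for a radius at which its growth is
  below \<open>exp (n^(4/5))\<close>, then pass to the subdirect product with such a finite 2-group. Its growth
  exceeds \<open>exp (\<mu> n)\<close> somewhere, but the extension is a finite 2-group, so it is refined by
  central steps of order 2, and the first step that exceeds \<open>exp \<mu>\<close> exceeds it by a factor
  of at most 2. Iterating with rapidly growing radii, the limit group oscillates as required, with
  growth at most \<open>2 exp (\<mu> n) < exp (\<mu> (9 n))\<close>.\<close>

subsection \<open>Marked groups as congruences on words\<close>

datatype gen = A | B | C | D

instance gen :: countable by countable_datatype

instance gen :: finite
proof
  have "(UNIV :: gen set) = {A, B, C, D}" using gen.exhaust by auto
  then show "finite (UNIV :: gen set)" by (metis finite.emptyI finite.insertI)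
qed

type_synonym wrel = "gen list \<Rightarrow> gen list \<Rightarrow> bool"

text \<open>A marked quotient of Z/2 * (Z/2 x Z/2): every letter is its own inverse, so the quotient
  monoid is a group. A smaller relation means a larger group.\<close>

definition gcong :: "wrel \<Rightarrow> bool" where
  "gcong R \<longleftrightarrow> equivp R \<and> (\<forall>u v x y. R u v \<longrightarrow> R x y \<longrightarrow> R (u @ x) (v @ y)) \<and>
     (\<forall>x. R [x, x] []) \<and> R [B, C] [D]"

lemma gcong_refl: "gcong R \<Longrightarrow> R u u"
  unfolding gcong_def by (meson equivp_reflp)

lemma gcong_sym: "gcong R \<Longrightarrow> R u v \<Longrightarrow> R v u"
  unfolding gcong_def by (meson equivp_symp)

lemma gcong_trans: "gcong R \<Longrightarrow> R u v \<Longrightarrow> R v w \<Longrightarrow> R u w"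
  unfolding gcong_def by (meson equivp_transp)

lemma gcong_append: "gcong R \<Longrightarrow> R u v \<Longrightarrow> R x y \<Longrightarrow> R (u @ x) (v @ y)"
  by (auto simp: gcong_def)

lemma gcong_sq: "gcong R \<Longrightarrow> R [x, x] []"
  by (auto simp: gcong_def)

lemma gcong_BC: "gcong R \<Longrightarrow> R [B, C] [D]"
  by (auto simp: gcong_def)

lemma gcong_eq: "gcong R \<Longrightarrow> R u = R v \<longleftrightarrow> R u v"
  unfolding gcong_def equivp_def by auto

lemma gcongI:
  assumes "\<And>u. R u u" "\<And>u v. R u v \<Longrightarrow> R v u" "\<And>u v w. R u v \<Longrightarrow> R v w \<Longrightarrow> R u w"
    and "\<And>u v x y. R u v \<Longrightarrow> R x y \<Longrightarrow> R (u @ x) (v @ y)" "\<And>x. R [x, x] []" "R [B, C] [D]"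
  shows "gcong R"
proof -
  have "equivp R"
    by (rule equivpI; (rule reflpI | rule sympI | rule transpI)) (fact assms)+
  then show ?thesis using assms(4-6) by (simp add: gcong_def)
qed

text \<open>Letters are involutions, so reversing a word inverts it.\<close>

lemma gcong_rev: assumes "gcong R" shows "R (rev u @ u) []"
proof (induction u)
  case (Cons x u)
  have "R (rev u @ [x, x] @ u) (rev u @ [] @ u)"
    by (intro gcong_append[OF assms] gcong_refl[OF assms] gcong_sq[OF assms])
  then show ?case using gcong_trans[OF assms _ Cons] by simp
qed (simp add: gcong_refl[OF assms])

lemma gcong_rev': assumes "gcong R" shows "R (u @ rev u) []"
  using gcong_rev[OF assms, of "rev u"] by simp

section \<open>The group of a congruence\<close>

definition code :: "wrel \<Rightarrow> gen list \<Rightarrow> nat" where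
  "code R w = (LEAST n. \<exists>v. R w v \<and> n = to_nat v)"

text \<open>Each class is represented by the least code of its words, which puts every such group on
  a carrier in \<open>nat\<close>.\<close>

definition wgrp :: "wrel \<Rightarrow> nat monoid" where
  "wgrp R = \<lparr>carrier = range (code R),
     mult = (\<lambda>x y. code R (from_nat x @ from_nat y)), one = code R []\<rparr>"

lemma code_rep: assumes "gcong R" shows "R w (from_nat (code R w))"
proof -
  have "\<exists>v. R w v \<and> code R w = to_nat v"
    unfolding code_def by (rule LeastI[of _ "to_nat w"]) (auto intro: gcong_refl[OF assms])
  then show ?thesis by auto
qed

lemma code_eq: assumes "gcong R" shows "code R u = code R v \<longleftrightarrow> R u v"
proof
  assume "code R u = code R v"
  then show "R u v" using code_rep[OF assms, of u] code_rep[OF assms, of v]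
    by (metis gcong_sym[OF assms] gcong_trans[OF assms])
next
  assume "R u v"
  then have "R u = R v" using gcong_eq[OF assms] by auto
  then show "code R u = code R v" by (simp add: code_def)
qed

lemma wgrp_mult: assumes "gcong R" shows "code R u \<otimes>\<^bsub>wgrp R\<^esub> code R v = code R (u @ v)"
proof -
  have "R (u @ v) (from_nat (code R u) @ from_nat (code R v))"
    by (intro gcong_append[OF assms] code_rep[OF assms])
  then have "code R (u @ v) = code R (from_nat (code R u) @ from_nat (code R v))"
    using code_eq[OF assms] by blast
  then show ?thesis by (simp add: wgrp_def)
qed

lemma wgrp_one: "\<one>\<^bsub>wgrp R\<^esub> = code R []"
  by (simp add: wgrp_def)

lemma wgrp_carrier: "carrier (wgrp R) = range (code R)"
  by (simp add: wgrp_def)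

lemma wgrp_group: assumes "gcong R" shows "group (wgrp R)"
proof (rule groupI)
  show "\<exists>y\<in>carrier (wgrp R). y \<otimes>\<^bsub>wgrp R\<^esub> x = \<one>\<^bsub>wgrp R\<^esub>" if x: "x \<in> carrier (wgrp R)" for x
  proof -
    obtain u where "x = code R u" using x by (auto simp: wgrp_carrier)
    then have "code R (rev u) \<otimes>\<^bsub>wgrp R\<^esub> x = \<one>\<^bsub>wgrp R\<^esub>"
      using gcong_rev[OF assms] by (simp add: wgrp_mult assms wgrp_one code_eq)
    then show ?thesis by (auto simp: wgrp_carrier)
  qed
qed (auto simp: wgrp_carrier wgrp_mult[OF assms] wgrp_one)

lemma wgrp_inv: assumes "gcong R" shows "inv\<^bsub>wgrp R\<^esub> (code R u) = code R (rev u)"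
proof -
  interpret group "wgrp R" by (rule wgrp_group[OF assms])
  show ?thesis
    by (rule inv_equality) (auto simp: wgrp_mult assms wgrp_one code_eq wgrp_carrier gcong_rev)
qed

section \<open>Word length and growth\<close>

definition letters :: "wrel \<Rightarrow> nat set" where
  "letters R = range (\<lambda>x. code R [x])"

lemma foldr_wgrp:
  assumes "gcong R"
  shows "foldr (\<otimes>\<^bsub>wgrp R\<^esub>) (map (\<lambda>x. code R [x]) w) \<one>\<^bsub>wgrp R\<^esub> = code R w"
  by (induction w) (auto simp: wgrp_one wgrp_mult[OF assms])

lemma wgrp_generating:
  assumes "gcong R" shows "finite_symmetric_generating_set (wgrp R) (letters R)"
proof -
  interpret group "wgrp R" by (rule wgrp_group[OF assms])
  have "code R w \<in> generate (wgrp R) (letters R)" for w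
  proof (induction w)
    case Nil
    then show ?case using generate.one[of "wgrp R"] by (simp add: wgrp_one)
  next
    case (Cons x w)
    have "code R [x] \<in> generate (wgrp R) (letters R)"
      by (intro generate.incl) (auto simp: letters_def)
    from generate.eng[OF this Cons] show ?case by (simp add: wgrp_mult[OF assms])
  qed
  moreover have "letters R \<subseteq> carrier (wgrp R)" by (auto simp: letters_def wgrp_carrier)
  moreover from this have "generate (wgrp R) (letters R) \<subseteq> carrier (wgrp R)"
    by (rule generate_incl)
  ultimately show ?thesis
    unfolding finite_symmetric_generating_set_def
    by (auto simp: letters_def wgrp_carrier wgrp_inv[OF assms])
qed

text \<open>\<open>R w\<close> is the class of \<open>w\<close> as a predicate, so the image under
  \<open>R\<close> of a set of words is its set of classes.\<close>

definition gr :: "wrel \<Rightarrow> nat \<Rightarrow> nat" where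
  "gr R n = card (R ` {w. length w \<le> n})"

lemma finite_words [simp]: "finite {w :: gen list. length w \<le> n}"
  using finite_lists_length_le[of "UNIV :: gen set" n] by simp

lemma map_letters: "set w \<subseteq> letters R \<Longrightarrow> \<exists>u. w = map (\<lambda>x. code R [x]) u"
  by (metis (no_types) ex_map_conv letters_def rangeE subset_iff)

text \<open>On \<open>S\<close> the map \<open>f\<close> factors through \<open>g\<close>, via a
  chosen preimage.\<close>

lemma card_image_le_factor:
  assumes "finite S" "\<And>x y. x \<in> S \<Longrightarrow> y \<in> S \<Longrightarrow> g x = g y \<Longrightarrow> f x = f y"
  shows "card (f ` S) \<le> card (g ` S)"
proof -
  have "f x = (f \<circ> inv_into S g) (g x)" if "x \<in> S" for x
    using assms(2)[OF that, of "inv_into S g (g x)"] that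
    by (simp add: f_inv_into_f inv_into_into)
  then have "f ` S = (f \<circ> inv_into S g) ` (g ` S)" by (simp add: image_image)
  then show ?thesis using card_image_le[of "g ` S" "f \<circ> inv_into S g"] assms(1) by simp
qed

lemma word_length_le:
  assumes "gcong R"
  shows "word_length (wgrp R) (letters R) (code R u) \<le> n \<longleftrightarrow> (\<exists>v. R u v \<and> length v \<le> n)"
proof
  let ?P = "\<lambda>k. \<exists>w. set w \<subseteq> letters R \<and> length w = k \<and>
     foldr (\<otimes>\<^bsub>wgrp R\<^esub>) w \<one>\<^bsub>wgrp R\<^esub> = code R u"
  have P: "?P (length v)" if "R u v" for v
    using that foldr_wgrp[OF assms, of v] code_eq[OF assms, of v u] gcong_sym[OF assms]
    by (intro exI[of _ "map (\<lambda>x. code R [x]) v"]) (auto simp: letters_def)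
  assume le: "word_length (wgrp R) (letters R) (code R u) \<le> n"
  have "?P (word_length (wgrp R) (letters R) (code R u))"
    unfolding word_length_def by (rule LeastI[where P = ?P, OF P[OF gcong_refl[OF assms]]])
  then obtain w where w: "set w \<subseteq> letters R" "length w \<le> n"
    "foldr (\<otimes>\<^bsub>wgrp R\<^esub>) w \<one>\<^bsub>wgrp R\<^esub> = code R u" using le by auto
  obtain v where v: "w = map (\<lambda>x. code R [x]) v" using map_letters[OF w(1)] by auto
  then have "code R v = code R u" using w(3) foldr_wgrp[OF assms] by simp
  then show "\<exists>v. R u v \<and> length v \<le> n"
    using code_eq[OF assms, of v u] gcong_sym[OF assms, of v u] w(2) v by auto
next
  assume "\<exists>v. R u v \<and> length v \<le> n"
  then obtain v where v: "R u v" "length v \<le> n" by auto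
  have "foldr (\<otimes>\<^bsub>wgrp R\<^esub>) (map (\<lambda>x. code R [x]) v) \<one>\<^bsub>wgrp R\<^esub> = code R u"
    using foldr_wgrp[OF assms] code_eq[OF assms] gcong_sym[OF assms] v(1) by simp
  then have "word_length (wgrp R) (letters R) (code R u) \<le> length v"
    unfolding word_length_def
    by (intro Least_le exI[of _ "map (\<lambda>x. code R [x]) v"]) (auto simp: letters_def)
  then show "word_length (wgrp R) (letters R) (code R u) \<le> n" using v(2) by simp
qed

lemma growth_wgrp:
  assumes "gcong R" shows "growth (wgrp R) (letters R) n = gr R n"
proof -
  let ?W = "{w :: gen list. length w \<le> n}"
  have "{g \<in> carrier (wgrp R). word_length (wgrp R) (letters R) g \<le> n} = code R ` ?W"
  proof (intro equalityI subsetI)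
    fix g assume "g \<in> {g \<in> carrier (wgrp R). word_length (wgrp R) (letters R) g \<le> n}"
    then obtain u where "g = code R u" "word_length (wgrp R) (letters R) (code R u) \<le> n"
      by (auto simp: wgrp_carrier)
    then show "g \<in> code R ` ?W" using word_length_le[OF assms] code_eq[OF assms] by auto
  next
    fix g assume "g \<in> code R ` ?W"
    then show "g \<in> {g \<in> carrier (wgrp R). word_length (wgrp R) (letters R) g \<le> n}"
      using word_length_le[OF assms] gcong_refl[OF assms] by (auto simp: wgrp_carrier)
  qed
  moreover have "card (code R ` ?W) = card (R ` ?W)"
    using card_image_le_factor[of ?W R "code R"] card_image_le_factor[of ?W "code R" R]
    by (simp add: code_eq[OF assms] gcong_eq[OF assms] order_antisym)
  ultimately show ?thesis by (simp add: growth_def gr_def)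
qed

text \<open>The class of \<open>f u\<close> determines the class of \<open>u\<close>, whether or not
  \<open>f\<close> is well defined on classes.\<close>

lemma gr_le_map:
  assumes "gcong R" "gcong R'" "\<And>u. length u \<le> n \<Longrightarrow> length (f u) \<le> n'"
    and "\<And>u v. R' (f u) (f v) \<Longrightarrow> R u v"
  shows "gr R n \<le> gr R' n'"
proof -
  have "gr R n \<le> card ((\<lambda>u. R' (f u)) ` {w. length w \<le> n})"
    unfolding gr_def by (rule card_image_le_factor) (auto simp: gcong_eq assms(1,2) assms(4))
  also have "\<dots> \<le> gr R' n'"
    unfolding gr_def using assms(3) by (intro card_mono) auto
  finally show ?thesis .
qed

lemma gr_antimono: "gcong R \<Longrightarrow> gcong R' \<Longrightarrow> R' \<le> R \<Longrightarrow> gr R n \<le> gr R' n"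
  by (rule gr_le_map[where f = id]) auto

lemma gr_cong:
  assumes "gcong R" "gcong R'" "\<And>u v. length u \<le> n \<Longrightarrow> length v \<le> n \<Longrightarrow> R u v = R' u v"
  shows "gr R n = gr R' n"
  unfolding gr_def
  by (rule order_antisym; rule card_image_le_factor)
    (simp_all add: gcong_eq[OF assms(1)] gcong_eq[OF assms(2)] assms(3))

lemma gr_pos: "gr R n > 0"
proof -
  have "R [] \<in> R ` {w. length w \<le> n}" by auto
  then show ?thesis unfolding gr_def by (metis card_gt_0_iff empty_iff finite_imageI finite_words)
qed

text \<open>The class modulo \<open>T\<close> is determined by the class modulo \<open>E\<close>
  together with the value of \<open>F\<close>.\<close>

lemma gr_finite_index:
  assumes "gcong T" "gcong E" "finite Y" "range F \<subseteq> Y"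
    and "\<And>u v. E u v \<Longrightarrow> F u = F v \<Longrightarrow> T u v"
  shows "gr T n \<le> card Y * gr E n"
proof -
  let ?W = "{w :: gen list. length w \<le> n}"
  have "gr T n \<le> card ((\<lambda>u. (F u, E u)) ` ?W)"
    unfolding gr_def by (rule card_image_le_factor) (auto simp: gcong_eq assms(1,2) assms(5))
  also have "\<dots> \<le> card (Y \<times> E ` ?W)"
    using assms(3,4) by (intro card_mono) auto
  finally show ?thesis by (simp add: gr_def card_cartesian_product)
qed

subsection \<open>The wreath recursion and Grigorchuk's group\<close>

text \<open>\<open>par\<close> is the action on the first level and \<open>sec\<close> the two coordinates of the recursion
  \<open>a = (1, 1) swap\<close>, \<open>b = (a, c)\<close>, \<open>c = (a, d)\<close>, \<open>d = (1, b)\<close>.\<close>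

fun par :: "gen list \<Rightarrow> bool" where
  "par [] = False"
| "par (x # w) = ((x = A) \<noteq> par w)"

fun sec :: "bool \<Rightarrow> gen list \<Rightarrow> gen list" where
  "sec i [] = []"
| "sec i (A # w) = sec (\<not> i) w"
| "sec i (B # w) = (if i then C else A) # sec i w"
| "sec i (C # w) = (if i then D else A) # sec i w"
| "sec i (D # w) = (if i then B # sec i w else sec i w)"

lemma par_append [simp]: "par (u @ v) = (par u \<noteq> par v)"
  by (induction u) auto

lemma sec_append: "sec i (u @ v) = sec i u @ sec (i \<noteq> par u) v"
  by (induction i u rule: sec.induct) auto

text \<open>The subgroup of the wreath product of the group of \<open>R\<close> with Z/2 that is
  generated by the recursion's images of the four letters.\<close>

definition Phi :: "wrel \<Rightarrow> wrel" where
  "Phi R u v \<longleftrightarrow> par u = par v \<and> (\<forall>i. R (sec i u) (sec i v))"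

lemma Phi_gcong: assumes R: "gcong R" shows "gcong (Phi R)"
proof (rule gcongI)
  show "Phi R [x, x] []" for x
    using gcong_refl[OF R] gcong_sq[OF R] by (cases x) (auto simp: Phi_def)
  \<comment> \<open>The recursion turns \<open>bc = d\<close> into \<open>cd = b\<close> in the
    coordinate \<open>True\<close>.\<close>
  have "R [C, D] [B]"
  proof -
    have "R ([B, B] @ [C, D]) ([] @ [C, D])" "R ([B] @ [B, C] @ [D]) ([B] @ [D] @ [D])"
      "R ([B] @ [D, D]) ([B] @ [])"
      by (intro gcong_append[OF R] gcong_refl[OF R] gcong_sq[OF R] gcong_BC[OF R])+
    then have "R [B, B, C, D] [C, D]" "R [B, B, C, D] [B, D, D]" "R [B, D, D] [B]" by simp_all
    then show ?thesis by (metis gcong_sym[OF R] gcong_trans[OF R])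
  qed
  then show "Phi R [B, C] [D]"
    using gcong_sq[OF R, of A] by (auto simp: Phi_def)
  show "Phi R (u @ x) (v @ y)" if "Phi R u v" "Phi R x y" for u v x y
    using that gcong_append[OF R] by (simp add: Phi_def sec_append)
qed (auto simp: Phi_def intro: gcong_refl[OF R] gcong_sym[OF R] gcong_trans[OF R])

lemma Phi_mono: "R \<le> R' \<Longrightarrow> Phi R \<le> Phi R'"
  by (auto simp: Phi_def le_fun_def)

section \<open>The free product and the direct limit over the levels\<close>

inductive T0 :: wrel where
  refl: "T0 u u"
| sym: "T0 u v \<Longrightarrow> T0 v u"
| trans: "T0 u v \<Longrightarrow> T0 v w \<Longrightarrow> T0 u w"
| append: "T0 u v \<Longrightarrow> T0 x y \<Longrightarrow> T0 (u @ x) (v @ y)"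
| sq: "T0 [x, x] []"
| BC: "T0 [B, C] [D]"

lemma T0_gcong: "gcong T0"
  by (rule gcongI) (fact T0.intros)+

lemma T0_least: assumes "gcong R" shows "T0 \<le> R"
proof (intro predicate2I)
  fix u v assume "T0 u v"
  then show "R u v"
  proof induction
    case (sym u v) show ?case by (rule gcong_sym[OF assms sym.IH])
  next
    case (trans u v w) show ?case by (rule gcong_trans[OF assms trans.IH])
  next
    case (append u v x y) show ?case by (rule gcong_append[OF assms append.IH])
  qed (rule gcong_refl[OF assms] gcong_sq[OF assms] gcong_BC[OF assms])+
qed

lemma Phi_pow_gcong: "gcong R \<Longrightarrow> gcong ((Phi ^^ k) R)"
  by (induction k) (auto intro: Phi_gcong)

lemma Phi_pow_mono: "R \<le> R' \<Longrightarrow> (Phi ^^ k) R \<le> (Phi ^^ k) R'"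
  by (induction k) (simp_all add: Phi_mono)

lemma Phi_pow_T0_mono: "k \<le> l \<Longrightarrow> (Phi ^^ k) T0 \<le> (Phi ^^ l) T0"
proof (rule lift_Suc_mono_le[where f = "\<lambda>k. (Phi ^^ k) T0"])
  show "(Phi ^^ n) T0 \<le> (Phi ^^ Suc n) T0" for n
    using Phi_pow_mono[OF T0_least[OF Phi_gcong[OF T0_gcong]], of n]
    by (simp add: funpow_swap1)
qed

text \<open>Grigorchuk's group. The relations grow with \<open>k\<close>, so finitely many
  equalities hold at a common stage.\<close>

definition E0 :: wrel where
  "E0 u v \<longleftrightarrow> (\<exists>k. (Phi ^^ k) T0 u v)"

lemma E0_join:
  assumes "E0 u v" "E0 x y" obtains k where "(Phi ^^ k) T0 u v" "(Phi ^^ k) T0 x y"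
proof -
  obtain k l where "(Phi ^^ k) T0 u v" "(Phi ^^ l) T0 x y" using assms by (auto simp: E0_def)
  then have "(Phi ^^ max k l) T0 u v" "(Phi ^^ max k l) T0 x y"
    using Phi_pow_T0_mono[of k "max k l"] Phi_pow_T0_mono[of l "max k l"] by auto
  then show ?thesis using that by blast
qed

lemma E0_gcong: "gcong E0"
proof (rule gcongI)
  note G = Phi_pow_gcong[OF T0_gcong]
  show "E0 u u" for u using gcong_refl[OF T0_gcong] by (auto simp: E0_def intro: exI[of _ 0])
  show "E0 v u" if "E0 u v" for u v using that gcong_sym[OF G] by (auto simp: E0_def)
  show "E0 u w" if "E0 u v" "E0 v w" for u v w
    using that by (rule E0_join) (auto simp: E0_def intro: gcong_trans[OF G])
  show "E0 (u @ x) (v @ y)" if "E0 u v" "E0 x y" for u v x y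
    using that by (rule E0_join) (auto simp: E0_def intro: gcong_append[OF G])
  show "E0 [x, x] []" for x using gcong_sq[OF T0_gcong] by (auto simp: E0_def intro: exI[of _ 0])
  show "E0 [B, C] [D]" using gcong_BC[OF T0_gcong] by (auto simp: E0_def intro: exI[of _ 0])
qed

text \<open>The recursion is injective on the limit: both sections agree at a common stage
  \<open>k\<close>, hence the words agree at stage \<open>Suc k\<close>.\<close>

lemma Phi_E0: "Phi E0 u v \<Longrightarrow> E0 u v"
proof -
  assume P: "Phi E0 u v"
  then have "E0 (sec False u) (sec False v)" "E0 (sec True u) (sec True v)"
    by (auto simp: Phi_def)
  then obtain k where "(Phi ^^ k) T0 (sec False u) (sec False v)"
    "(Phi ^^ k) T0 (sec True u) (sec True v)" by (rule E0_join)
  then have "(Phi ^^ k) T0 (sec i u) (sec i v)" for i by (cases i) simp_all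
  then have "(Phi ^^ Suc k) T0 u v" using P by (simp add: Phi_def)
  then show ?thesis unfolding E0_def by blast
qed

text \<open>On words of bounded length, finitely many relations of the direct limit are in play.\<close>

lemma E0_ball: "\<exists>k. \<forall>u v. length u \<le> r \<longrightarrow> length v \<le> r \<longrightarrow> E0 u v \<longrightarrow> (Phi ^^ k) T0 u v"
proof -
  let ?W = "{w :: gen list. length w \<le> r}"
  let ?P = "{p \<in> ?W \<times> ?W. E0 (fst p) (snd p)}"
  have "\<forall>p\<in>?P. \<exists>k. (Phi ^^ k) T0 (fst p) (snd p)" by (auto simp: E0_def)
  from bchoice[OF this] obtain f
    where f: "\<forall>p\<in>?P. (Phi ^^ f p) T0 (fst p) (snd p)" by blast
  have fin: "finite (f ` ?P)" by (intro finite_imageI finite_subset[of ?P "?W \<times> ?W"]) auto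
  have "(Phi ^^ Max (f ` ?P)) T0 u v" if "length u \<le> r" "length v \<le> r" "E0 u v" for u v
  proof -
    have "(u, v) \<in> ?P" using that by simp
    then have "f (u, v) \<le> Max (f ` ?P)" using fin by (intro Max_ge) auto
    from Phi_pow_T0_mono[OF this] bspec[OF f \<open>(u, v) \<in> ?P\<close>] show ?thesis by auto
  qed
  then show ?thesis by blast
qed

text \<open>A right inverse of \<open>sec False\<close>. Each letter becomes a word of even parity,
  so reading stays in the same coordinate; \<open>b\<close>, \<open>c\<close>, \<open>d\<close>
  arise as sections at \<open>True\<close> of \<open>d\<close>, \<open>b\<close>, \<open>c\<close>,
  reached by conjugating with \<open>a\<close>.\<close>

fun lift :: "gen list \<Rightarrow> gen list" where
  "lift [] = []"
| "lift (A # w) = B # lift w"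
| "lift (B # w) = A # D # A # lift w"
| "lift (C # w) = A # B # A # lift w"
| "lift (D # w) = A # C # A # lift w"

lemma sec_lift [simp]: "sec False (lift w) = w"
  by (induction w rule: lift.induct) auto

lemma length_lift: "length (lift w) \<le> 3 * length w"
  by (induction w rule: lift.induct) auto

lemma gr_Phi: assumes "gcong R" shows "gr R n \<le> gr (Phi R) (3 * n)"
proof (rule gr_le_map[OF assms Phi_gcong[OF assms]])
  show "length (lift u) \<le> 3 * n" if "length u \<le> n" for u
    using length_lift[of u] that by simp
  show "R u v" if "Phi R (lift u) (lift v)" for u v
    using that by (metis Phi_def sec_lift)
qed

text \<open>Each level costs a factor 3 in radius, so fast growth of the sections survives
  \<open>k\<close> levels at a rate divided by \<open>3 ^ k\<close>.\<close>

lemma gr_Phi_pow: assumes "gcong R" shows "gr R n \<le> gr ((Phi ^^ k) R) (3 ^ k * n)"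
proof (induction k)
  case (Suc k)
  note Suc
  also have "gr ((Phi ^^ k) R) (3 ^ k * n) \<le> gr ((Phi ^^ Suc k) R) (3 * (3 ^ k * n))"
    using gr_Phi[OF Phi_pow_gcong[OF assms]] by simp
  finally show ?case by (simp add: mult.assoc)
qed simp

subsection \<open>Contraction\<close>

text \<open>The weights are small-integer approximations to Bartholdi's optimal ones; they contract by
  5/6, and 5/6 is less than the fourth root of 1/2, which is what the exponent 4/5 requires.\<close>

fun wt1 :: "gen \<Rightarrow> nat" where
  "wt1 A = 7" | "wt1 B = 8" | "wt1 C = 5" | "wt1 D = 3"

definition wt :: "gen list \<Rightarrow> nat" where
  "wt w = sum_list (map wt1 w)"

lemma wt_simps [simp]: "wt [] = 0" "wt (x # w) = wt1 x + wt w"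
  by (simp_all add: wt_def)

text \<open>Normal forms of the free product Z/2 * (Z/2 x Z/2).\<close>

fun alt :: "gen list \<Rightarrow> bool" where
  "alt [] = True"
| "alt [x] = True"
| "alt (x # y # w) = ((x = A) \<noteq> (y = A) \<and> alt (y # w))"

text \<open>The product of two of \<open>b\<close>, \<open>c\<close>, \<open>d\<close> is the third,
  and the weights 8, 5, 3 satisfy the triangle inequality.\<close>

lemma gcong_V4:
  assumes R: "gcong R" and "x \<noteq> A" "y \<noteq> A" "x \<noteq> y"
  obtains z where "z \<noteq> A" "R [x, y] [z]" "wt1 z \<le> wt1 x + wt1 y"
proof -
  have app: "R (a @ u @ b) (a @ v @ b)" if "R u v" for a b u v
    using that by (intro gcong_append[OF R] gcong_refl[OF R])
  note tr = gcong_trans[OF R] and sy = gcong_sym[OF R]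
  \<comment> \<open>Swapping factors and rotating the letters yields all six products from
    \<open>bc = d\<close>.\<close>
  have flip: "R [y, x] [z]" if "R [x, y] [z]" for x y z
  proof -
    have *: "R [y, x] [y, x, z, z]" using app[OF sy[OF gcong_sq[OF R, of z]], of "[y, x]" "[]"] by simp
    have "R [y, x, z, z] [y, x, x, y, z]"
      using app[OF sy[OF that], of "[y, x]" "[z]"] by simp
    moreover have "R [y, x, x, y, z] [y, y, z]"
      using app[OF gcong_sq[OF R, of x], of "[y]" "[y, z]"] by simp
    moreover have "R [y, y, z] [z]" using app[OF gcong_sq[OF R, of y], of "[]" "[z]"] by simp
    ultimately show ?thesis using * tr by blast
  qed
  have rot: "R [y, z] [x]" if "R [x, y] [z]" for x y z
  proof -
    have "R [y, z] [y, x, y]" using app[OF sy[OF that], of "[y]" "[]"] by simp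
    moreover have "R [y, x, y] [z, y]" using app[OF flip[OF that], of "[]" "[y]"] by simp
    moreover have "R [z, y] [x, y, y]" using app[OF sy[OF that], of "[]" "[y]"] by simp
    moreover have "R [x, y, y] [x]" using app[OF gcong_sq[OF R, of y], of "[x]" "[]"] by simp
    ultimately show ?thesis using tr by blast
  qed
  have 1: "R [B, C] [D]" by (rule gcong_BC[OF R])
  have 2: "R [C, D] [B]" by (rule rot[OF 1])
  have 3: "R [D, B] [C]" by (rule rot[OF 2])
  show ?thesis
    using that assms(2-4) 1 2 3 flip[OF 1] flip[OF 2] flip[OF 3]
    by (cases x; cases y) fastforce+
qed

lemma alt_Cons:
  assumes R: "gcong R" and w: "alt w"
  shows "\<exists>v. alt v \<and> R (x # w) v \<and> wt v \<le> wt1 x + wt w"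
proof (cases w)
  case Nil
  then show ?thesis using gcong_refl[OF R] by (intro exI[of _ "[x]"]) simp
next
  case (Cons y w')
  consider "(x = A) \<noteq> (y = A)" | "x = y" | "x \<noteq> A" "y \<noteq> A" "x \<noteq> y" by blast
  then show ?thesis
  proof cases
    case 1
    then show ?thesis using Cons w gcong_refl[OF R] by (intro exI[of _ "x # w"]) simp
  next
    case 2
    have "R ([x, x] @ w') ([] @ w')" by (intro gcong_append[OF R] gcong_refl[OF R] gcong_sq[OF R])
    moreover have "alt w'" using w Cons by (cases w') auto
    ultimately show ?thesis using Cons 2 by (intro exI[of _ w']) simp
  next
    case 3
    then obtain z where z: "z \<noteq> A" "R [x, y] [z]" "wt1 z \<le> wt1 x + wt1 y"
      using gcong_V4[OF R] by metis
    have "R ([x, y] @ w') ([z] @ w')" by (intro gcong_append[OF R] gcong_refl[OF R] z(2))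
    moreover have "alt (z # w')" using w Cons z(1) 3(2) by (cases w') auto
    ultimately show ?thesis using Cons z(3) by (intro exI[of _ "z # w'"]) simp
  qed
qed

lemma alt_reduce:
  assumes R: "gcong R"
  shows "\<exists>v. alt v \<and> R w v \<and> wt v \<le> wt w"
proof (induction w)
  case Nil
  then show ?case using gcong_refl[OF R] by (intro exI[of _ "[]"]) simp
next
  case (Cons x w)
  then obtain v where v: "alt v" "R w v" "wt v \<le> wt w" by blast
  from alt_Cons[OF R v(1)] obtain v' where v': "alt v'" "R (x # v) v'" "wt v' \<le> wt1 x + wt v"
    by blast
  have "R ([x] @ w) ([x] @ v)" by (intro gcong_append[OF R] gcong_refl[OF R] v(2))
  then have "R (x # w) v'" using gcong_trans[OF R] v'(2) by simp
  then show ?case using v' v(3) by (intro exI[of _ v']) simp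
qed

text \<open>The sections of \<open>b\<close>, \<open>c\<close>, \<open>d\<close> weigh 12, 10, 8 in
  total, while the letter with an adjacent \<open>a\<close> weighs 15, 12, 10: a ratio of at most
  5/6. An unpaired leading letter leaves an excess of at most 6 * 10 - 5 * 5 = 35, which an
  \<open>a\<close> put in front absorbs because 5 * 7 = 35.\<close>

lemma wt_sec:
  assumes "alt w"
  shows "6 * (wt (sec i w) + wt (sec (\<not> i) w)) \<le>
    5 * wt w + (case w of [] \<Rightarrow> 0 | x # _ \<Rightarrow> if x = A then 0 else 35)"
  using assms
proof (induction w arbitrary: i rule: alt.induct)
  case (2 x)
  then show ?case by (cases x; cases i) auto
next
  case (3 x y w)
  then have IH: "6 * (wt (sec i (y # w)) + wt (sec (\<not> i) (y # w))) \<le>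
    5 * wt (y # w) + (if y = A then 0 else 35)" for i by force
  show ?case using IH[of i] IH[of "\<not> i"] 3(2) by (cases x; cases "y = A"; cases i) auto
qed simp

definition G0 :: "nat \<Rightarrow> nat" where
  "G0 n = card (E0 ` {w. wt w \<le> n})"

lemma length_le_wt: "3 * length w \<le> wt w"
proof (induction w)
  case (Cons x w) then show ?case by (cases x) auto
qed simp

lemma wt_le_length: "wt w \<le> 8 * length w"
proof (induction w)
  case (Cons x w) then show ?case by (cases x) auto
qed simp

lemma finite_wt [simp]: "finite {w. wt w \<le> n}"
proof (rule finite_subset[OF _ finite_words[of n]])
  have "length w \<le> n" if "wt w \<le> n" for w using length_le_wt[of w] that by simp
  then show "{w. wt w \<le> n} \<subseteq> {w. length w \<le> n}" by auto
qed

lemma gr_E0_le: "gr E0 n \<le> G0 (8 * n)"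
proof -
  have "wt w \<le> 8 * n" if "length w \<le> n" for w using wt_le_length[of w] that by simp
  then show ?thesis unfolding gr_def G0_def by (intro card_mono) auto
qed

text \<open>An element is determined by its parity and two sections, whose weights add up to at most
  \<open>5 * (n + 7) / 6\<close> for a normal form. The index \<open>i\<close> is the weight of the
  section at \<open>False\<close>.\<close>

lemma G0_rec: "G0 n \<le> 2 * (\<Sum>i\<le>5 * (n + 7) div 6. G0 i * G0 (5 * (n + 7) div 6 - i))"
proof -
  let ?N = "5 * (n + 7) div 6"
  let ?A = "{w. alt w \<and> wt w \<le> n}"
  let ?f = "\<lambda>w. (par w, E0 (sec False w), E0 (sec True w))"
  let ?B = "\<lambda>i. E0 ` {w. wt w \<le> i}"
  have fin: "finite ?A" by (rule finite_subset[OF _ finite_wt[of n]]) auto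
  \<comment> \<open>Normal forms suffice, since reduction does not raise the weight.\<close>
  have "?B n \<subseteq> E0 ` ?A"
  proof
    fix c assume "c \<in> ?B n"
    then obtain w where w: "c = E0 w" "wt w \<le> n" by auto
    obtain v where v: "alt v" "E0 w v" "wt v \<le> wt w" using alt_reduce[OF E0_gcong] by blast
    then have "c = E0 v" using w gcong_eq[OF E0_gcong] by simp
    then show "c \<in> E0 ` ?A" using v w by auto
  qed
  then have "G0 n \<le> card (E0 ` ?A)"
    unfolding G0_def by (intro card_mono finite_imageI fin)
  also have "\<dots> \<le> card (?f ` ?A)"
  proof (rule card_image_le_factor[OF fin])
    fix u v assume "?f u = ?f v"
    then have eq: "par u = par v" "E0 (sec False u) (sec False v)" "E0 (sec True u) (sec True v)"
      by (simp_all add: gcong_eq[OF E0_gcong])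
    then have "E0 (sec i u) (sec i v)" for i by (cases i) simp_all
    then have "Phi E0 u v" using eq(1) by (simp add: Phi_def)
    from Phi_E0[OF this] show "E0 u = E0 v" by (simp add: gcong_eq[OF E0_gcong])
  qed
  also have "\<dots> \<le> card ((UNIV :: bool set) \<times> (\<Union>i\<le>?N. ?B i \<times> ?B (?N - i)))"
  proof (rule card_mono)
    show "?f ` ?A \<subseteq> UNIV \<times> (\<Union>i\<le>?N. ?B i \<times> ?B (?N - i))"
    proof
      fix c assume "c \<in> ?f ` ?A"
      then obtain w where w: "c = ?f w" "alt w" "wt w \<le> n" by auto
      have "6 * (wt (sec False w) + wt (sec True w)) \<le> 5 * wt w + 35"
        using wt_sec[OF w(2), of False] by (auto split: list.splits if_splits)
      then have le: "wt (sec False w) + wt (sec True w) \<le> ?N"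
        using w(3) by (simp add: less_eq_div_iff_mult_less_eq)
      then have "wt (sec False w) \<le> ?N" "wt (sec True w) \<le> ?N - wt (sec False w)" by auto
      then show "c \<in> UNIV \<times> (\<Union>i\<le>?N. ?B i \<times> ?B (?N - i))" using w(1) by blast
    qed
  qed auto
  also have "\<dots> = 2 * card (\<Union>i\<le>?N. ?B i \<times> ?B (?N - i))"
    by (simp add: card_cartesian_product)
  also have "\<dots> \<le> 2 * (\<Sum>i\<le>?N. card (?B i \<times> ?B (?N - i)))"
    by (intro mult_left_mono card_UN_le) auto
  finally show ?thesis by (simp add: G0_def card_cartesian_product)
qed

lemma G0_pos: "G0 n > 0"
proof -
  have "E0 [] \<in> E0 ` {w. wt w \<le> n}" by auto
  then show ?thesis unfolding G0_def by (metis card_gt_0_iff empty_iff finite_imageI finite_wt)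
qed

subsection \<open>Finite 2-groups\<close>

text \<open>Descending chains of subgroups of index at most 2. Working with sets of words makes such chains
  pull back along \<open>sec\<close>, which is how finite 2-groups are recognised here.\<close>

inductive tower :: "gen list set \<Rightarrow> bool" where
  UNIV: "tower UNIV"
| step: "tower K \<Longrightarrow> (\<And>u v. u \<in> K \<Longrightarrow> v \<in> K \<Longrightarrow> f (u @ v) = (f u \<noteq> f v)) \<Longrightarrow>
    tower {w \<in> K. \<not> f w}"

lemma tower_append: "tower K \<Longrightarrow> u \<in> K \<Longrightarrow> v \<in> K \<Longrightarrow> u @ v \<in> K"
  by (induction rule: tower.induct) auto

text \<open>Multiplicativity on \<open>L\<close> alone is what \<open>sec\<close> offers: it is
  multiplicative on words of even parity.\<close>

lemma tower_preimage:
  assumes "tower L" "\<And>u v. u \<in> L \<Longrightarrow> v \<in> L \<Longrightarrow> h (u @ v) = h u @ h v" "tower K"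
  shows "tower {w \<in> L. h w \<in> K}"
  using assms(3)
proof (induction rule: tower.induct)
  case UNIV
  then show ?case using assms(1) by simp
next
  case (step K f)
  have "tower {w \<in> {w \<in> L. h w \<in> K}. \<not> f (h w)}"
    by (rule tower.step[OF step.IH]) (simp add: assms(2) step.hyps(2))
  then show ?case by (simp add: conj_assoc)
qed

lemma tower_Int: assumes "tower L" "tower K" shows "tower (L \<inter> K)"
  using tower_preimage[of L "\<lambda>w. w", OF assms(1) _ assms(2)] by (simp add: Int_def)

text \<open>Then the group of \<open>N\<close> is finite, and its exponent is a power of 2.\<close>

definition towered :: "wrel \<Rightarrow> bool" where
  "towered N \<longleftrightarrow> (\<exists>K. tower K \<and> (\<forall>w\<in>K. N w []))"

lemma towered_Phi: assumes "towered N" shows "towered (Phi N)"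
proof -
  obtain K where K: "tower K" "\<forall>w\<in>K. N w []" using assms by (auto simp: towered_def)
  have even: "tower {w \<in> UNIV. \<not> par w}" by (rule tower.step[OF tower.UNIV]) simp
  have "tower {w \<in> {w \<in> UNIV. \<not> par w}. sec i w \<in> K}" for i
    by (rule tower_preimage[OF even _ K(1)]) (simp add: sec_append)
  from tower_Int[OF this[of False] this[of True]]
  have "tower {w. \<not> par w \<and> (\<forall>i. sec i w \<in> K)}"
    by (rule back_subst[of tower]) (auto simp: all_bool_eq)
  then show ?thesis unfolding towered_def using K(2)
    by (intro exI conjI) (auto simp: Phi_def)
qed

lemma towered_Phi_pow: "towered N \<Longrightarrow> towered ((Phi ^^ k) N)"
  by (induction k) (auto intro: towered_Phi)

text \<open>\<open>X\<close> consists of inverses of coset representatives. A proper step doubles it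
  by prefixing an element \<open>s\<close> outside the smaller subgroup.\<close>

lemma tower_reps: assumes "tower K" shows "\<exists>X. finite X \<and> (\<forall>w. \<exists>x\<in>X. x @ w \<in> K)"
  using assms
proof (induction rule: tower.induct)
  case UNIV
  then show ?case by (intro exI[of _ "{[]}"]) simp
next
  case (step K f)
  then obtain X where X: "finite X" "\<And>w. \<exists>x\<in>X. x @ w \<in> K" by blast
  show ?case
  proof (cases "\<exists>s\<in>K. f s")
    case True
    then obtain s where s: "s \<in> K" "f s" by blast
    have "\<exists>x\<in>X \<union> (@) s ` X. x @ w \<in> {w \<in> K. \<not> f w}" for w
    proof -
      obtain x where x: "x \<in> X" "x @ w \<in> K" using X(2) by blast
      have "f (s @ x @ w) = (\<not> f (x @ w))" using step.hyps(2)[OF s(1) x(2)] s(2) by simp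
      moreover have "s @ x @ w \<in> K" using tower_append[OF step.hyps(1) s(1) x(2)] .
      ultimately show ?thesis
        using x by (intro bexI[of _ "if f (x @ w) then s @ x else x"]) auto
    qed
    then show ?thesis using X(1) by (intro exI[of _ "X \<union> (@) s ` X"]) simp
  next
    case False
    then have "{w \<in> K. \<not> f w} = K" by auto
    then show ?thesis using X by auto
  qed
qed

lemma gcong_cancel:
  assumes R: "gcong R" and "R (x @ u) []" "R (x @ v) []" shows "R u v"
proof -
  have "R (x @ u) (x @ v)" using assms(2,3) by (metis gcong_sym[OF R] gcong_trans[OF R])
  from gcong_append[OF R gcong_refl[OF R, of "rev x"] this]
  have "R (rev x @ x @ u) (rev x @ x @ v)" .
  moreover have "R (rev x @ x @ w) w" for w
    using gcong_append[OF R gcong_rev[OF R, of x] gcong_refl[OF R, of w]] by simp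
  ultimately show ?thesis by (metis gcong_sym[OF R] gcong_trans[OF R])
qed

text \<open>\<open>F w\<close> is chosen with \<open>F w @ w\<close> in \<open>K\<close>, so it
  represents the inverse of \<open>w\<close> modulo \<open>N\<close>.\<close>

lemma towered_finite_index:
  assumes "gcong N" "towered N"
  obtains X :: "gen list set" and F where "finite X" "range F \<subseteq> X" "\<And>u v. F u = F v \<Longrightarrow> N u v"
proof -
  obtain K where K: "tower K" "\<forall>w\<in>K. N w []" using assms by (auto simp: towered_def)
  obtain X where X: "finite X" "\<forall>w. \<exists>x\<in>X. x @ w \<in> K" using tower_reps[OF K(1)] by blast
  then obtain F where F: "\<And>w. F w \<in> X" "\<And>w. F w @ w \<in> K" by metis
  have "N u v" if "F u = F v" for u v
    using gcong_cancel[OF assms(1), of "F u" u v] F(2)[of u] F(2)[of v] that K(2) by simp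
  then show ?thesis using that X(1) F(1) by blast
qed

definition pw :: "gen list \<Rightarrow> nat \<Rightarrow> gen list" where
  "pw w n = concat (replicate n w)"

lemma pw_add: "pw w (m + n) = pw w m @ pw w n"
  by (simp add: pw_def replicate_add)

text \<open>Squaring kills a homomorphism to Z/2, so each step of the tower costs one
  squaring.\<close>

lemma tower_pw: assumes "tower K" shows "\<exists>t. \<forall>w. pw w (2 ^ t) \<in> K"
  using assms
proof (induction rule: tower.induct)
  case (step K f)
  then obtain t where t: "\<And>w. pw w (2 ^ t) \<in> K" by blast
  have "pw w (2 ^ Suc t) \<in> {w \<in> K. \<not> f w}" for w
    using step.hyps(2)[OF t[of w] t[of w]] tower_append[OF step.hyps(1) t[of w] t[of w]]
      pw_add[of w "2 ^ t" "2 ^ t"] by (simp add: mult_2)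
  then show ?case by blast
qed simp

subsection \<open>The lamplighter over a finite dihedral group\<close>

text \<open>\<open>a\<close> and \<open>b\<close> act as two reflections of the sites, \<open>c\<close> toggles the lamp at site 0, and \<open>d = bc\<close>.
  In \<open>ac w p\<close> the letters act from the left end of \<open>w\<close>, so \<open>ac w\<close> is the inverse of the group element.
  The sign \<open>neg\<close> is part of the congruence so that the cases \<open>q = 1, 2\<close> need no special treatment.\<close>

fun mirror :: "gen \<Rightarrow> int \<Rightarrow> int" where
  "mirror A p = 1 - p" | "mirror B p = - p" | "mirror C p = p" | "mirror D p = - p"

fun ac :: "gen list \<Rightarrow> int \<Rightarrow> int" where
  "ac [] p = p" | "ac (x # w) p = ac w (mirror x p)"

text \<open>The parity of the number of toggles that the trajectory of \<open>p\<close> meets at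
  sites divisible by \<open>q\<close>.\<close>

fun lam :: "int \<Rightarrow> gen list \<Rightarrow> int \<Rightarrow> bool" where
  "lam q [] p = False"
| "lam q (x # w) p = ((x \<in> {C, D} \<and> q dvd p) \<noteq> lam q w (mirror x p))"

fun neg :: "gen list \<Rightarrow> bool" where
  "neg [] = False" | "neg (x # w) = ((x \<noteq> C) \<noteq> neg w)"

definition Lam :: "int \<Rightarrow> wrel" where
  "Lam q u v \<longleftrightarrow> neg u = neg v \<and> q dvd ac u 0 - ac v 0 \<and> (\<forall>p. lam q u p = lam q v p)"

lemma ac_eq: "ac w p = ac w 0 + (if neg w then - p else p)"
proof (induction w arbitrary: p)
  case (Cons x w)
  have "ac w (mirror x p) = ac w 0 + (if neg w then - mirror x p else mirror x p)"
    "ac w (mirror x 0) = ac w 0 + (if neg w then - mirror x 0 else mirror x 0)" by (rule Cons)+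
  then show ?case by (cases x) auto
qed simp

lemma ac_append [simp]: "ac (u @ v) p = ac v (ac u p)"
  by (induction u arbitrary: p) auto

lemma neg_append [simp]: "neg (u @ v) = (neg u \<noteq> neg v)"
  by (induction u) auto

lemma lam_append [simp]: "lam q (u @ v) p = (lam q u p \<noteq> lam q v (ac u p))"
  by (induction u arbitrary: p) auto

lemma lam_periodic: "q dvd p - p' \<Longrightarrow> lam q w p = lam q w p'"
proof (induction w arbitrary: p p')
  case (Cons x w)
  have "q dvd mirror x p - mirror x p'"
    using Cons.prems by (cases x) (auto simp: dvd_diff_commute)
  moreover have "q dvd p \<longleftrightarrow> q dvd p'"
    using Cons.prems by (metis dvd_diff_right_iff dvd_diff_commute)
  ultimately show ?case using Cons.IH by simp
qed simp

lemma Lam_ac: "Lam q u v \<Longrightarrow> q dvd ac u p - ac v p"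
  using ac_eq[of u p] ac_eq[of v p] by (auto simp: Lam_def)

lemma Lam_gcong: "gcong (Lam q)"
proof (rule gcongI)
  show "Lam q (u @ x) (v @ y)" if uv: "Lam q u v" and xy: "Lam q x y" for u v x y
  proof -
    have "q dvd ac x (ac u 0) - ac y (ac v 0)"
    proof -
      have "q dvd ac x (ac u 0) - ac y (ac u 0)" by (rule Lam_ac[OF xy])
      moreover have "ac y (ac u 0) - ac y (ac v 0) =
          (if neg y then - (ac u 0 - ac v 0) else ac u 0 - ac v 0)"
        using ac_eq[of y "ac u 0"] ac_eq[of y "ac v 0"] by auto
      moreover have "q dvd (if neg y then - (ac u 0 - ac v 0) else ac u 0 - ac v 0)"
        using uv by (simp add: Lam_def dvd_diff_commute)
      ultimately have "q dvd (ac x (ac u 0) - ac y (ac u 0)) + (ac y (ac u 0) - ac y (ac v 0))"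
        by (intro dvd_add) (simp_all only:)
      then show ?thesis by simp
    qed
    moreover have "lam q x (ac u p) = lam q y (ac v p)" for p
      using lam_periodic[OF Lam_ac[OF uv], where w = x] xy by (simp add: Lam_def)
    ultimately show ?thesis using uv xy by (simp add: Lam_def)
  qed
  show "Lam q [x, x] []" for x by (cases x) (auto simp: Lam_def)
  show "Lam q u w" if "Lam q u v" "Lam q v w" for u v w
  proof -
    have "q dvd (ac u 0 - ac v 0) + (ac v 0 - ac w 0)"
      using that by (intro dvd_add) (simp_all add: Lam_def)
    then show ?thesis using that by (simp add: Lam_def)
  qed
qed (auto simp: Lam_def dvd_diff_commute)

text \<open>The chain kills first the sign, then the binary digits of the translation, then the
  lamps one at a time.\<close>

lemma Lam_towered: "towered (Lam (2 ^ j))"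
proof -
  have neg: "tower {w \<in> UNIV. \<not> neg w}" by (rule tower.step[OF tower.UNIV]) simp
  have pos: "tower {w. \<not> neg w \<and> 2 ^ i dvd ac w 0}" for i
  proof (induction i)
    case 0
    show ?case using neg by simp
  next
    case (Suc i)
    \<comment> \<open>On translations by multiples of \<open>2 ^ i\<close>, the parity of the
      quotient is additive.\<close>
    have "(\<not> 2 ^ Suc i dvd ac (u @ v) 0) = ((\<not> 2 ^ Suc i dvd ac u 0) \<noteq> (\<not> 2 ^ Suc i dvd ac v 0))"
      if u: "\<not> neg u" "2 ^ i dvd ac u 0" and v: "\<not> neg v" "2 ^ i dvd ac v 0" for u v
    proof -
      obtain a b where "ac u 0 = 2 ^ i * a" "ac v 0 = 2 ^ i * b" using u v by (auto elim!: dvdE)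
      moreover from this have "ac (u @ v) 0 = 2 ^ i * (a + b)"
        using ac_eq[of v "ac u 0"] v(1) by (simp add: algebra_simps)
      ultimately show ?thesis by (simp add: mult.commute[of 2])
    qed
    then have "tower {w \<in> {w. \<not> neg w \<and> 2 ^ i dvd ac w 0}. \<not> (\<not> 2 ^ Suc i dvd ac w 0)}"
      by (intro tower.step[OF Suc.IH]) blast
    then show ?case
      by (rule back_subst[of tower]) (auto intro: dvd_trans[OF le_imp_power_dvd[of i "Suc i"]])
  qed
  define q :: int where "q = 2 ^ j"
  let ?K = "\<lambda>m. {w. \<not> neg w \<and> q dvd ac w 0 \<and> (\<forall>p<m. \<not> lam q w (int p))}"
  have lamps: "tower (?K m)" for m
  proof (induction m)
    case 0
    show ?case using pos[of j] by (simp add: q_def)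
  next
    case (Suc m)
    \<comment> \<open>Words in \<open>?K m\<close> fix every site modulo \<open>q\<close>, so each
      lamp is a homomorphism on them.\<close>
    have "lam q (u @ v) (int m) = (lam q u (int m) \<noteq> lam q v (int m))"
      if "u \<in> ?K m" "v \<in> ?K m" for u v
      using that ac_eq[of u "int m"] lam_periodic[of q "ac u (int m)" "int m" v] by simp
    then have "tower {w \<in> ?K m. \<not> lam q w (int m)}" by (rule tower.step[OF Suc.IH])
    then show ?case by (rule back_subst[of tower]) (auto simp: less_Suc_eq)
  qed
  have "Lam q w []" if "w \<in> ?K (nat q)" for w
  proof -
    have "\<not> lam q w p" for p
    proof -
      have "q > 0" by (simp add: q_def)
      then have "p mod q = int (nat (p mod q))" "nat (p mod q) < nat q" by auto
      then have "\<not> lam q w (p mod q)" using that by (metis (mono_tags, lifting) mem_Collect_eq)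
      then show ?thesis
        using lam_periodic[of q p "p mod q" w] by (simp add: mod_eq_dvd_iff[symmetric])
    qed
    then show ?thesis using that by (simp add: Lam_def)
  qed
  then show ?thesis unfolding towered_def q_def[symmetric] using lamps by blast
qed

text \<open>\<open>ab\<close> translates sites by -1, so the optional \<open>c\<close> before the
  \<open>i\<close>-th \<open>ab\<close> (from 0) toggles the lamp at site \<open>i\<close>.\<close>

fun lights :: "bool list \<Rightarrow> gen list" where
  "lights [] = []"
| "lights (b # bs) = (if b then [C] else []) @ A # B # lights bs"

lemma length_lights: "length (lights bs) \<le> 3 * length bs"
  by (induction bs) auto

text \<open>The sites at which toggles are tested lie strictly between \<open>-q\<close> and
  \<open>q\<close>, so 0 is the only multiple of \<open>q\<close> among them.\<close>

lemma lam_lights: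
  assumes "int (length bs) \<le> q" "int (length bs) - q \<le> p" "p < q"
  shows "lam q (lights bs) p \<longleftrightarrow> 0 \<le> p \<and> p < int (length bs) \<and> bs ! nat p"
  using assms
proof (induction bs arbitrary: p)
  case (Cons b bs)
  have "q dvd p \<longleftrightarrow> p = 0"
    using Cons.prems zdvd_not_zless[of "\<bar>p\<bar>" q] by (cases "p = 0") auto
  moreover have "lam q (lights bs) (p - 1) \<longleftrightarrow>
      0 \<le> p - 1 \<and> p - 1 < int (length bs) \<and> bs ! nat (p - 1)"
    using Cons.prems by (intro Cons.IH) auto
  ultimately show ?case
    by (cases "p > 0") (auto simp: nth_Cons' nat_diff_distrib)
qed simp

lemma gr_Lam: assumes "int m \<le> q" shows "2 ^ m \<le> gr (Lam q) (3 * m)"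
proof -
  let ?S = "{bs :: bool list. length bs = m}"
  have fin: "finite ?S" using finite_lists_length_eq[of "UNIV :: bool set" m] by simp
  have "2 ^ m = card ((\<lambda>bs. bs) ` ?S)" using card_lists_length_eq[of "UNIV :: bool set" m] by simp
  also have "\<dots> \<le> card ((\<lambda>bs. Lam q (lights bs)) ` ?S)"
  proof (rule card_image_le_factor[OF fin])
    fix bs cs assume "bs \<in> ?S" "cs \<in> ?S" and eq: "Lam q (lights bs) = Lam q (lights cs)"
    then have len: "length bs = m" "length cs = m" by auto
    have "bs ! i = cs ! i" if "i < m" for i
    proof -
      have "lam q (lights bs) (int i) = lam q (lights cs) (int i)"
        using eq by (simp add: gcong_eq[OF Lam_gcong] Lam_def)
      then show ?thesis
        using lam_lights[of bs q "int i"] lam_lights[of cs q "int i"] len that assms by auto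
    qed
    then show "bs = cs" using len by (simp add: list_eq_iff_nth_eq)
  qed
  also have "\<dots> \<le> gr (Lam q) (3 * m)"
    unfolding gr_def
  proof (rule card_mono)
    have "length (lights bs) \<le> 3 * m" if "length bs = m" for bs
      using length_lights[of bs] that by simp
    then show "(\<lambda>bs. Lam q (lights bs)) ` ?S \<subseteq> Lam q ` {w. length w \<le> 3 * m}" by auto
  qed simp
  finally show ?thesis .
qed

subsection \<open>Central involutions\<close>

context group
begin

lemma inv_cancel_left [simp]:
  assumes "x \<in> carrier G" "y \<in> carrier G"
  shows "inv x \<otimes> (x \<otimes> y) = y" "x \<otimes> (inv x \<otimes> y) = y"
  using assms by (simp_all add: m_assoc[symmetric])

lemma conj_eq_inv_conj:
  assumes "p \<in> carrier G" "s \<in> carrier G" and pss: "p \<otimes> (s \<otimes> s) = (s \<otimes> s) \<otimes> p"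
  shows "s \<otimes> p \<otimes> inv s = inv s \<otimes> p \<otimes> s"
proof -
  have "inv s \<otimes> (p \<otimes> (s \<otimes> s)) \<otimes> inv s = inv s \<otimes> ((s \<otimes> s) \<otimes> p) \<otimes> inv s" by (simp only: pss)
  then show ?thesis using assms(1,2) by (simp add: m_assoc)
qed

text \<open>Meant for an index-2 subgroup centralised by \<open>p\<close>, with \<open>k\<close>
  inside and \<open>s\<close> outside: then \<open>s s\<close> and \<open>s k s\<close> lie inside,
  and the conjugate of \<open>p\<close> centralises the subgroup too.\<close>

lemma conj_commute:
  assumes "p \<in> carrier G" "s \<in> carrier G" "k \<in> carrier G"
    and pss: "p \<otimes> (s \<otimes> s) = (s \<otimes> s) \<otimes> p" and psks: "p \<otimes> (s \<otimes> k \<otimes> s) = (s \<otimes> k \<otimes> s) \<otimes> p"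
  shows "(s \<otimes> p \<otimes> inv s) \<otimes> k = k \<otimes> (s \<otimes> p \<otimes> inv s)"
proof -
  have "inv s \<otimes> (p \<otimes> (s \<otimes> k \<otimes> s)) \<otimes> inv s = inv s \<otimes> ((s \<otimes> k \<otimes> s) \<otimes> p) \<otimes> inv s"
    by (simp only: psks)
  then have "inv s \<otimes> p \<otimes> s \<otimes> k = k \<otimes> (s \<otimes> p \<otimes> inv s)"
    using assms(1-3) by (simp add: m_assoc)
  then show ?thesis using conj_eq_inv_conj[OF assms(1,2) pss] by simp
qed

lemma conj_pow:
  assumes "s \<in> carrier G" "r \<in> carrier G"
  shows "s \<otimes> r [^] (n::nat) \<otimes> inv s = (s \<otimes> r \<otimes> inv s) [^] n"
proof (induction n)
  case (Suc n)
  have "s \<otimes> r [^] Suc n \<otimes> inv s = (s \<otimes> r [^] n \<otimes> inv s) \<otimes> (s \<otimes> r \<otimes> inv s)"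
    using assms by (simp add: m_assoc)
  then show ?case using Suc by simp
qed (use assms in simp)

text \<open>\<open>p\<close> and its conjugate by \<open>s\<close> generate a dihedral group in which conjugation by \<open>s\<close> inverts the
  rotation; an involution among the rotations is therefore centralised by \<open>s\<close>.\<close>

lemma conj_commutator_pow:
  assumes "p \<in> carrier G" "s \<in> carrier G" and pp: "p \<otimes> p = \<one>"
    and pss: "p \<otimes> (s \<otimes> s) = (s \<otimes> s) \<otimes> p"
    and u: "u = (p \<otimes> (s \<otimes> p \<otimes> inv s)) [^] (n::nat)" "u \<otimes> u = \<one>"
  shows "s \<otimes> u = u \<otimes> s"
proof -
  let ?q = "s \<otimes> p \<otimes> inv s"
  let ?r = "p \<otimes> ?q"
  have inv_p: "inv p = p" by (rule inv_equality[OF pp assms(1,1)])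
  \<comment> \<open>Conjugation by \<open>s\<close> sends \<open>p\<close> to \<open>?q\<close>, and
    \<open>?q\<close> back to \<open>p\<close> since \<open>p\<close> commutes with
    \<open>s s\<close>.\<close>
  have "s \<otimes> ?q \<otimes> inv s = p"
    using conj_eq_inv_conj[OF assms(1,2) pss] assms(1,2) by (simp add: m_assoc)
  moreover have "s \<otimes> ?r \<otimes> inv s = ?q \<otimes> (s \<otimes> ?q \<otimes> inv s)"
    using assms(1,2) by (simp add: m_assoc)
  ultimately have "s \<otimes> ?r \<otimes> inv s = ?q \<otimes> p" by simp
  also have "\<dots> = inv ?r" using assms(1,2) inv_p by (simp add: inv_mult_group m_assoc)
  finally have "s \<otimes> u \<otimes> inv s = inv ?r [^] n" using conj_pow[of s ?r n] u(1) assms(1,2) by simp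
  also have "\<dots> = inv u" using u(1) assms(1,2) by (simp add: nat_pow_inv)
  also have "\<dots> = u" using u assms(1,2) by (intro inv_equality) auto
  finally have eq: "s \<otimes> u \<otimes> inv s = u" .
  have uc: "u \<in> carrier G" using u(1) assms(1,2) by simp
  have "s \<otimes> u = (s \<otimes> u \<otimes> inv s) \<otimes> s" using uc assms(2) by (simp add: m_assoc)
  then show ?thesis using eq by simp
qed

lemma pow_commute:
  assumes "r \<in> carrier G" "k \<in> carrier G" "r \<otimes> k = k \<otimes> r"
  shows "r [^] (n::nat) \<otimes> k = k \<otimes> r [^] n"
proof (induction n)
  case (Suc n)
  have "r [^] Suc n \<otimes> k = r [^] n \<otimes> k \<otimes> r" using assms by (simp add: m_assoc)
  also have "\<dots> = k \<otimes> r [^] Suc n" using Suc assms by (simp add: m_assoc)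
  finally show ?case .
qed (use assms in simp)

end

section \<open>Powers and conjugates of words\<close>

lemma code_pw: assumes "gcong T" shows "code T (pw w n) = code T w [^]\<^bsub>wgrp T\<^esub> n"
proof -
  interpret group "wgrp T" by (rule wgrp_group[OF assms])
  show ?thesis
  proof (induction n)
    case (Suc n)
    have "pw w (Suc n) = pw w n @ w" using pw_add[of w n 1] by (simp add: pw_def)
    then show ?case using Suc by (simp add: wgrp_mult[OF assms, symmetric])
  qed (simp add: pw_def wgrp_one)
qed

lemma gcong_append_null: "gcong R \<Longrightarrow> R u [] \<Longrightarrow> R v [] \<Longrightarrow> R (u @ v) []"
  using gcong_append[of R u "[]" v "[]"] by simp

lemma gcong_pw_null: assumes "gcong R" "R w []" shows "R (pw w n) []"
  by (induction n) (auto simp: pw_def intro: gcong_refl gcong_append_null assms)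

lemma gcong_conj_null:
  assumes R: "gcong R" and p: "R p []" shows "R (s @ p @ rev s) []"
proof -
  have "R (s @ p @ rev s) (s @ [] @ rev s)"
    by (intro gcong_append[OF R] gcong_refl[OF R] p)
  then show ?thesis using gcong_trans[OF R _ gcong_rev'[OF R]] by simp
qed

lemma last_nontrivial_power:
  assumes "T (pw w (2 ^ t)) []" "\<not> T w []"
  obtains n where "\<not> T (pw w (2 ^ n)) []" "T (pw w (2 ^ n) @ pw w (2 ^ n)) []"
proof -
  define l where "l = (LEAST l. T (pw w (2 ^ l)) [])"
  have l: "T (pw w (2 ^ l)) []" unfolding l_def by (rule LeastI[of _ t]) (rule assms(1))
  have "pw w (2 ^ 0) = w" by (simp add: pw_def)
  then obtain n where n: "l = Suc n" using l assms(2) by (cases l) auto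
  have "\<not> T (pw w (2 ^ n)) []"
    using not_less_Least[of n "\<lambda>l. T (pw w (2 ^ l)) []"] n by (simp add: l_def)
  moreover have "pw w (2 ^ n) @ pw w (2 ^ n) = pw w (2 ^ l)"
    using pw_add[of w "2 ^ n" "2 ^ n"] n by (simp add: mult_2)
  ultimately show ?thesis using l that by metis
qed

text \<open>Here \<open>p\<close> centralises the kernel of \<open>f\<close> in \<open>K\<close>.
  Take \<open>s\<close> in \<open>K\<close> outside it and let \<open>r\<close> be the product of
  \<open>p\<close> with its conjugate by \<open>s\<close>. If \<open>r\<close> is trivial,
  \<open>p\<close> commutes with \<open>s\<close>; otherwise the last nontrivial 2-power of
  \<open>r\<close> is an involution that commutes with \<open>s\<close> and with the kernel, hence
  with \<open>K\<close>.\<close>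

lemma central_involution_step:
  assumes T: "gcong T" and E: "gcong E"
    and ord: "\<And>w. E w [] \<Longrightarrow> T (pw w (2 ^ t)) []"
    and K: "tower K" "\<And>u v. u \<in> K \<Longrightarrow> v \<in> K \<Longrightarrow> f (u @ v) = (f u \<noteq> f v)"
    and p: "E p []" "\<not> T p []" "T (p @ p) []" "\<And>k. k \<in> K \<Longrightarrow> \<not> f k \<Longrightarrow> T (p @ k) (k @ p)"
  shows "\<exists>p. E p [] \<and> \<not> T p [] \<and> T (p @ p) [] \<and> (\<forall>k\<in>K. T (p @ k) (k @ p))"
proof (cases "\<exists>s\<in>K. f s")
  case False
  then show ?thesis using p by blast
next
  case True
  then obtain s where s: "s \<in> K" "f s" by blast
  interpret group "wgrp T" by (rule wgrp_group[OF T])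
  let ?c = "code T"
  have c [simp]: "?c u \<in> carrier (wgrp T)" for u by (simp add: wgrp_carrier)
  note m = wgrp_mult[OF T, symmetric]
  have comm: "T (u @ v) (v @ u) \<longleftrightarrow> ?c u \<otimes>\<^bsub>wgrp T\<^esub> ?c v = ?c v \<otimes>\<^bsub>wgrp T\<^esub> ?c u" for u v
    by (simp add: code_eq[OF T, symmetric] m)
  have null: "T u [] \<longleftrightarrow> ?c u = \<one>\<^bsub>wgrp T\<^esub>" for u
    by (simp add: code_eq[OF T, symmetric] wgrp_one)
  have pp: "?c p \<otimes>\<^bsub>wgrp T\<^esub> ?c p = \<one>\<^bsub>wgrp T\<^esub>" using p(3) by (simp add: null m)
  have "s @ s \<in> K" "\<not> f (s @ s)" using tower_append[OF K(1) s(1) s(1)] K(2)[OF s(1) s(1)] by auto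
  from p(4)[OF this] have pss: "?c p \<otimes>\<^bsub>wgrp T\<^esub> (?c s \<otimes>\<^bsub>wgrp T\<^esub> ?c s) =
      (?c s \<otimes>\<^bsub>wgrp T\<^esub> ?c s) \<otimes>\<^bsub>wgrp T\<^esub> ?c p" by (simp only: comm m)
  define q where "q = s @ p @ rev s"
  define r where "r = p @ q"
  have cq: "?c q = ?c s \<otimes>\<^bsub>wgrp T\<^esub> ?c p \<otimes>\<^bsub>wgrp T\<^esub> inv\<^bsub>wgrp T\<^esub> ?c s"
    by (simp add: q_def m m_assoc wgrp_inv[OF T])
  have qk: "?c q \<otimes>\<^bsub>wgrp T\<^esub> ?c k = ?c k \<otimes>\<^bsub>wgrp T\<^esub> ?c q" if k: "k \<in> K" "\<not> f k" for k
  proof -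
    have sk: "s @ k \<in> K" "f (s @ k)" using tower_append[OF K(1) s(1) k(1)] K(2)[OF s(1) k(1)] s k by auto
    have "(s @ k) @ s \<in> K" "\<not> f ((s @ k) @ s)"
      using tower_append[OF K(1) sk(1) s(1)] K(2)[OF sk(1) s(1)] s sk by auto
    from p(4)[OF this] show ?thesis
      unfolding cq by (intro conj_commute pss c) (simp only: comm m)
  qed
  have rk: "?c r \<otimes>\<^bsub>wgrp T\<^esub> ?c k = ?c k \<otimes>\<^bsub>wgrp T\<^esub> ?c r" if k: "k \<in> K" "\<not> f k" for k
  proof -
    have pk: "?c p \<otimes>\<^bsub>wgrp T\<^esub> ?c k = ?c k \<otimes>\<^bsub>wgrp T\<^esub> ?c p" using p(4)[OF k] by (simp only: comm)
    have "?c r \<otimes>\<^bsub>wgrp T\<^esub> ?c k = ?c p \<otimes>\<^bsub>wgrp T\<^esub> (?c k \<otimes>\<^bsub>wgrp T\<^esub> ?c q)"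
      by (simp add: r_def m m_assoc qk[OF k])
    also have "\<dots> = (?c k \<otimes>\<^bsub>wgrp T\<^esub> ?c p) \<otimes>\<^bsub>wgrp T\<^esub> ?c q" by (simp add: m_assoc[symmetric] pk)
    finally show ?thesis by (simp add: r_def m m_assoc)
  qed
  have Er: "E r []" unfolding r_def q_def by (intro gcong_append_null[OF E] gcong_conj_null[OF E] p(1))
  have "\<exists>u. E u [] \<and> \<not> T u [] \<and> T (u @ u) [] \<and> T (s @ u) (u @ s) \<and>
    (\<forall>k\<in>K. \<not> f k \<longrightarrow> T (u @ k) (k @ u))"
  proof (cases "T r []")
    case True
    then have "?c p \<otimes>\<^bsub>wgrp T\<^esub> ?c q = ?c p \<otimes>\<^bsub>wgrp T\<^esub> ?c p" using pp by (simp add: r_def null m)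
    then have "?c q = ?c p" by simp
    then have "?c s \<otimes>\<^bsub>wgrp T\<^esub> ?c p = ?c p \<otimes>\<^bsub>wgrp T\<^esub> ?c s"
      unfolding cq by (metis c inv_closed inv_solve_right m_closed)
    then have "T (s @ p) (p @ s)" by (simp add: comm)
    then show ?thesis using p by blast
  next
    case False
    obtain n where n: "\<not> T (pw r (2 ^ n)) []" "T (pw r (2 ^ n) @ pw r (2 ^ n)) []"
      using last_nontrivial_power[where T = T, OF ord[OF Er] False] by blast
    define u where "u = pw r (2 ^ n)"
    have u: "\<not> T u []" and uu: "T (u @ u) []" using n by (simp_all add: u_def)
    have cu: "?c u = ?c r [^]\<^bsub>wgrp T\<^esub> ((2::nat) ^ n)" by (simp add: u_def code_pw[OF T])
    have "?c s \<otimes>\<^bsub>wgrp T\<^esub> ?c u = ?c u \<otimes>\<^bsub>wgrp T\<^esub> ?c s"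
    proof (rule conj_commutator_pow[OF c c pp pss])
      show "?c u = (?c p \<otimes>\<^bsub>wgrp T\<^esub> (?c s \<otimes>\<^bsub>wgrp T\<^esub> ?c p \<otimes>\<^bsub>wgrp T\<^esub> inv\<^bsub>wgrp T\<^esub> ?c s))
          [^]\<^bsub>wgrp T\<^esub> ((2::nat) ^ n)" by (simp only: cu r_def m cq)
    qed (use uu in \<open>simp add: null m\<close>)
    moreover have "?c u \<otimes>\<^bsub>wgrp T\<^esub> ?c k = ?c k \<otimes>\<^bsub>wgrp T\<^esub> ?c u" if "k \<in> K" "\<not> f k" for k
      unfolding cu by (rule pow_commute[OF c c rk[OF that]])
    moreover have "E u []" unfolding u_def by (rule gcong_pw_null[OF E Er])
    ultimately show ?thesis using u uu by (auto simp only: comm)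
  qed
  then obtain u where u: "E u []" "\<not> T u []" "T (u @ u) []" "T (s @ u) (u @ s)"
    and uk: "\<And>k. k \<in> K \<Longrightarrow> \<not> f k \<Longrightarrow> T (u @ k) (k @ u)" by blast
  have "T (u @ k) (k @ u)" if k: "k \<in> K" for k
  proof (cases "f k")
    case True
    have "s @ k \<in> K" "\<not> f (s @ k)"
      using tower_append[OF K(1) s(1) k] K(2)[OF s(1) k] s True by auto
    from uk[OF this] have "?c u \<otimes>\<^bsub>wgrp T\<^esub> (?c s \<otimes>\<^bsub>wgrp T\<^esub> ?c k) =
        (?c s \<otimes>\<^bsub>wgrp T\<^esub> ?c k) \<otimes>\<^bsub>wgrp T\<^esub> ?c u" by (simp only: comm m)
    moreover have "?c u \<otimes>\<^bsub>wgrp T\<^esub> (?c s \<otimes>\<^bsub>wgrp T\<^esub> ?c k) =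
        ?c s \<otimes>\<^bsub>wgrp T\<^esub> (?c u \<otimes>\<^bsub>wgrp T\<^esub> ?c k)"
      using u(4) by (simp add: comm m_assoc[symmetric])
    ultimately have "?c s \<otimes>\<^bsub>wgrp T\<^esub> (?c u \<otimes>\<^bsub>wgrp T\<^esub> ?c k) =
        ?c s \<otimes>\<^bsub>wgrp T\<^esub> (?c k \<otimes>\<^bsub>wgrp T\<^esub> ?c u)" by (simp add: m_assoc)
    then show ?thesis by (simp add: comm)
  qed (use uk k in blast)
  then show ?thesis using u by blast
qed

text \<open>Finite 2-groups meet nontrivial normal subgroups in central involutions.\<close>

lemma central_involution:
  assumes T: "gcong T" and E: "gcong E" and N: "gcong N" "towered N"
    and EN: "\<And>u v. E u v \<Longrightarrow> N u v \<Longrightarrow> T u v" and w: "E w []" "\<not> T w []"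
  obtains z where "E z []" "\<not> T z []" "T (z @ z) []" "\<And>u. T (z @ u) (u @ z)"
proof -
  obtain K where K: "tower K" "\<forall>w\<in>K. N w []" using N(2) by (auto simp: towered_def)
  obtain t where t: "\<And>w. pw w (2 ^ t) \<in> K" using tower_pw[OF K(1)] by blast
  have ord: "T (pw w (2 ^ t)) []" if "E w []" for w
    using EN[OF gcong_pw_null[OF E that]] t K(2) by blast
  \<comment> \<open>The commutator dies modulo \<open>E\<close> because of \<open>p\<close> and
    modulo \<open>N\<close> because of \<open>k\<close>, hence modulo \<open>T\<close>.\<close>
  have commK: "T (p @ k) (k @ p)" if p: "E p []" and k: "k \<in> K" for p k
  proof (rule EN)
    have "E (p @ k) k" using gcong_append[OF E p gcong_refl[OF E, of k]] by simp
    moreover have "E (k @ p) k" using gcong_append[OF E gcong_refl[OF E, of k] p] by simp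
    ultimately show "E (p @ k) (k @ p)" by (rule gcong_trans[OF E _ gcong_sym[OF E]])
    have k: "N k []" using k K(2) by blast
    have "N (p @ k) p" using gcong_append[OF N(1) gcong_refl[OF N(1), of p] k] by simp
    moreover have "N (k @ p) p" using gcong_append[OF N(1) k gcong_refl[OF N(1), of p]] by simp
    ultimately show "N (p @ k) (k @ p)" by (rule gcong_trans[OF N(1) _ gcong_sym[OF N(1)]])
  qed
  \<comment> \<open>Climb the tower to all words, one step of index at most 2 at a time.\<close>
  have up: "(\<exists>p. E p [] \<and> \<not> T p [] \<and> T (p @ p) [] \<and> (\<forall>k\<in>L. T (p @ k) (k @ p))) \<Longrightarrow>
    \<exists>p. E p [] \<and> \<not> T p [] \<and> T (p @ p) [] \<and> (\<forall>k. T (p @ k) (k @ p))" if "tower L" for L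
    using that
  proof (induction rule: tower.induct)
    case (step L f)
    from step.prems obtain p where p: "E p []" "\<not> T p []" "T (p @ p) []"
      "\<And>k. k \<in> L \<Longrightarrow> \<not> f k \<Longrightarrow> T (p @ k) (k @ p)" by blast
    show ?case
      by (rule step.IH) (rule central_involution_step[OF T E ord step.hyps(1,2) p])
  qed simp
  obtain n where n: "\<not> T (pw w (2 ^ n)) []" "T (pw w (2 ^ n) @ pw w (2 ^ n)) []"
    using last_nontrivial_power[where T = T, OF ord[OF w(1)] w(2)] by blast
  with gcong_pw_null[OF E w(1)] show ?thesis using up[OF K(1)] commK that by blast
qed

subsection \<open>Interpolation and the oscillating limit\<close>

lemma gcong_null_iff: assumes R: "gcong R" shows "R (u @ rev v) [] \<longleftrightarrow> R u v"
proof
  assume "R (u @ rev v) []"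
  from gcong_append[OF R this gcong_refl[OF R, of v]] have "R (u @ rev v @ v) v" by simp
  moreover have "R (u @ rev v @ v) u"
    using gcong_append[OF R gcong_refl[OF R, of u] gcong_rev[OF R, of v]] by simp
  ultimately show "R u v" using gcong_sym[OF R] gcong_trans[OF R] by blast
next
  assume "R u v"
  from gcong_append[OF R this gcong_refl[OF R, of "rev v"]] show "R (u @ rev v) []"
    using gcong_trans[OF R _ gcong_rev'[OF R]] by blast
qed

lemma gcong_inf: assumes "gcong R" "gcong R'" shows "gcong (inf R R')"
  using assms by (intro gcongI)
    (auto simp: inf_fun_def intro: gcong_refl gcong_append gcong_sq gcong_BC
      dest: gcong_sym gcong_trans)

text \<open>\<open>T'\<close> is the quotient by the central subgroup generated by \<open>z\<close>;
  each of its classes splits into at most two classes of \<open>T\<close>.\<close>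

lemma adjoin_central_involution:
  assumes T: "gcong T" and z: "T (z @ z) []" "\<And>u. T (z @ u) (u @ z)"
  defines "T' \<equiv> \<lambda>u v. T u v \<or> T u (z @ v)"
  shows "gcong T'" "gr T n \<le> 2 * gr T' n"
proof -
  note tr = gcong_trans[OF T] and sy = gcong_sym[OF T] and ap = gcong_append[OF T]
    and re = gcong_refl[OF T]
  have zz: "T (z @ z @ u) u" for u using ap[OF z(1) re, of u] by simp
  have zv: "T (z @ u) (z @ v)" if "T u v" for u v by (rule ap[OF re that])
  have swap: "T (z @ u) v" if "T u (z @ v)" for u v by (rule tr[OF zv[OF that] zz])
  have slide: "T (u @ z @ x) (z @ u @ x)" for u x
    using ap[OF sy[OF z(2)] re, of u x] by simp
  show T': "gcong T'"
  proof (rule gcongI)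
    show "T' v u" if "T' u v" for u v using that sy swap unfolding T'_def by blast
    show "T' u w" if uv: "T' u v" and vw: "T' v w" for u v w
    proof -
      have "T u v \<and> T v w \<or> T u v \<and> T v (z @ w) \<or> T u (z @ v) \<and> T v w \<or> T u (z @ v) \<and> T v (z @ w)"
        using uv vw by (auto simp: T'_def)
      moreover have "T u w" if "T u (z @ v)" "T v (z @ w)" by (rule tr[OF tr[OF that(1) zv[OF that(2)]] zz])
      moreover have "T u (z @ w)" if "T u (z @ v)" "T v w" by (rule tr[OF that(1) zv[OF that(2)]])
      ultimately show ?thesis using tr unfolding T'_def by blast
    qed
    show "T' (u @ x) (v @ y)" if uv: "T' u v" and xy: "T' x y" for u v x y
    proof -
      consider "T u v" "T x y" | "T u v" "T x (z @ y)" | "T u (z @ v)" "T x y"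
        | "T u (z @ v)" "T x (z @ y)" using uv xy by (auto simp: T'_def)
      then show ?thesis
      proof cases
        case 1
        then show ?thesis using ap by (simp add: T'_def)
      next
        case 2
        from tr[OF ap[OF this] slide] show ?thesis by (simp add: T'_def)
      next
        case 3
        from ap[OF this] show ?thesis by (simp add: T'_def)
      next
        case 4
        from ap[OF this] have "T (u @ x) (z @ v @ z @ y)" by simp
        from tr[OF tr[OF this zv[OF slide]] zz] show ?thesis by (simp add: T'_def)
      qed
    qed
  qed (auto simp: T'_def re gcong_sq[OF T] gcong_BC[OF T])
  \<comment> \<open>Tells the two \<open>T\<close>-classes in a \<open>T'\<close>-class apart by
    comparison with a chosen word of it.\<close>
  define F where "F u = T u (SOME c. T' u c)" for u
  have "gr T n \<le> card (UNIV :: bool set) * gr T' n"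
  proof (rule gr_finite_index[OF T T', where F = F])
    fix u v assume uv: "T' u v" and F: "F u = F v"
    define c where "c = (SOME c. T' u c)"
    have c': "c = (SOME c. T' v c)" unfolding c_def using uv gcong_eq[OF T'] by metis
    have "T' u c" "T' v c" unfolding c' using uv c'[unfolded c_def] someI[of "T' u" u] someI[of "T' v" v]
        gcong_refl[OF T'] by metis+
    moreover have "T u c \<longleftrightarrow> T v c" using F c' by (simp add: F_def c_def)
    ultimately have "T u c \<and> T v c \<or> T u (z @ c) \<and> T v (z @ c)" by (auto simp: T'_def)
    then show "T u v" using tr sy by blast
  qed auto
  then show "gr T n \<le> 2 * gr T' n" by simp
qed

text \<open>A discrete intermediate value theorem: \<open>T'\<close> is the quotient of \<open>T\<close> by a central involution,
  and \<open>T\<close> is the last bad congruence on the way up from \<open>inf E N\<close> to \<open>E\<close>.\<close>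

lemma interpolate:
  assumes E: "gcong E" and N: "gcong N" "towered N" and bad: "bad (inf E N)" "\<not> bad E"
  obtains T T' where "gcong T" "gcong T'" "inf E N \<le> T" "T \<le> E" "bad T" "\<not> bad T'"
    "\<And>n. gr T n \<le> 2 * gr T' n"
proof -
  obtain X :: "gen list set" and F where X: "finite X" "range F \<subseteq> X" "\<And>u v. F u = F v \<Longrightarrow> N u v"
    using towered_finite_index[OF N] by blast
  define M where "M = {w. E w []}"
  \<comment> \<open>Finitely many words of the kernel of \<open>E\<close> that represent, modulo
    \<open>N\<close>, the whole kernel.\<close>
  define Y where "Y = inv_into M F ` (F ` M)"
  have "F ` M \<subseteq> X" using X(2) by auto
  then have "finite (F ` M)" using X(1) by (rule finite_subset)
  then have finY: "finite Y" unfolding Y_def by (rule finite_imageI)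
  have Y: "\<exists>y\<in>Y. E y [] \<and> N y w" if "E w []" for w
  proof -
    have w: "F w \<in> F ` M" using that by (auto simp: M_def)
    have "inv_into M F (F w) \<in> M" "F (inv_into M F (F w)) = F w"
      using inv_into_into[OF w] f_inv_into_f[OF w] by auto
    then show ?thesis using X(3) w unfolding Y_def M_def by blast
  qed
  \<comment> \<open>Measures how much of the kernel of \<open>E\<close> is killed; it is bounded by
    \<open>card Y\<close>, so a bad congruence can be chosen to maximise it.\<close>
  define meas where "meas T = card {y \<in> Y. T y []}" for T :: wrel
  define Q where "Q T \<longleftrightarrow> gcong T \<and> inf E N \<le> T \<and> T \<le> E \<and> bad T" for T
  have Q: "Q (inf E N)" using gcong_inf[OF E N(1)] bad(1) by (simp add: Q_def)
  have "meas T < Suc (card Y)" for T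
    unfolding meas_def less_Suc_eq_le using finY by (intro card_mono) auto
  then have "\<exists>T. Q T \<and> (\<forall>T'. Q T' \<longrightarrow> meas T' \<le> meas T)"
    by (intro ex_has_greatest_nat[where P = Q, OF Q]) blast
  then obtain T where T: "Q T" and max: "\<And>T'. Q T' \<Longrightarrow> meas T' \<le> meas T" by blast
  have gT: "gcong T" and le: "inf E N \<le> T" "T \<le> E" and bT: "bad T"
    using T by (auto simp: Q_def)
  have EN: "T u v" if "E u v" "N u v" for u v using le(1) that by (auto simp: le_fun_def)
  have "T \<noteq> E" using bT bad(2) by auto
  then obtain u v where "E u v" "\<not> T u v" using le(2) by (auto simp: le_fun_def fun_eq_iff)
  then have "E (u @ rev v) []" "\<not> T (u @ rev v) []" by (simp_all add: gcong_null_iff E gT)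
  then obtain z where z: "E z []" "\<not> T z []" "T (z @ z) []" "\<And>u. T (z @ u) (u @ z)"
    using central_involution[OF gT E N EN] by metis
  define T' where "T' = (\<lambda>u v. T u v \<or> T u (z @ v))"
  have T': "gcong T'" "\<And>n. gr T n \<le> 2 * gr T' n"
    unfolding T'_def by (rule adjoin_central_involution[OF gT z(3,4)])+
  have "T' u v \<Longrightarrow> E u v" for u v
  proof -
    assume "T' u v"
    then have "E u v \<or> E u (z @ v)" using le(2) by (auto simp: T'_def)
    moreover have "E (z @ v) v" using gcong_append[OF E z(1) gcong_refl[OF E, of v]] by simp
    ultimately show ?thesis using gcong_trans[OF E] by blast
  qed
  then have T'E: "T' \<le> E" by auto
  have TT': "T \<le> T'" by (auto simp: T'_def)
  \<comment> \<open>The representative of \<open>z\<close> is killed by \<open>T'\<close> but not by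
    \<open>T\<close>, so the measure strictly increases.\<close>
  obtain y where y: "y \<in> Y" "E y []" "N y z" using Y[OF z(1)] by blast
  have yz: "T y z" using EN[OF gcong_trans[OF E y(2) gcong_sym[OF E z(1)]] y(3)] .
  then have "T' y []" by (simp add: T'_def)
  moreover have "\<not> T y []" using gcong_trans[OF gT gcong_sym[OF gT yz]] z(2) by blast
  ultimately have "meas T < meas T'"
    unfolding meas_def using finY y(1) TT' by (intro psubset_card_mono) auto
  then have "\<not> Q T'" using max by (simp add: not_le[symmetric]) blast
  then have "\<not> bad T'" using T'(1) T'E le(1) TT' by (auto simp: Q_def)
  then show ?thesis using that gT T' le bT by blast
qed

text \<open>In a state \<open>(E, n)\<close> the ball of radius \<open>n\<close> is final: later congruences agree with \<open>E\<close> on it.\<close>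

definition admissible :: "(nat \<Rightarrow> real) \<Rightarrow> wrel \<times> nat \<Rightarrow> bool" where
  "admissible \<mu> = (\<lambda>(E, n). gcong E \<and> E \<le> E0 \<and> (\<exists>C. \<forall>m. gr E m \<le> C * gr E0 m) \<and>
     (\<forall>m\<ge>n. gr E m \<le> 2 * exp (\<mu> m)))"

text \<open>One oscillation: growth is slow at \<open>r\<close> and fast at \<open>n'\<close>, both
  within the ball that is final in the new state.\<close>

definition successor :: "(nat \<Rightarrow> real) \<Rightarrow> wrel \<times> nat \<Rightarrow> wrel \<times> nat \<Rightarrow> bool" where
  "successor \<mu> = (\<lambda>(E, n) (E', n'). E' \<le> E \<and> n < n' \<and>
     (\<forall>u v. length u \<le> n \<longrightarrow> length v \<le> n \<longrightarrow> E u v \<longrightarrow> E' u v) \<and>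
     (\<exists>r. n \<le> r \<and> r \<le> n' \<and> gr E' r < exp (real r powr (4 / 5))) \<and>
     exp (\<mu> n') < gr E' n' \<and> (\<forall>m\<ge>n. gr E' m \<le> 2 * exp (\<mu> m)))"

section \<open>One oscillation and the limit\<close>

context
  fixes \<mu> :: "nat \<Rightarrow> real"
  assumes mu_sublinear: "\<And>c. c > 0 \<Longrightarrow> \<forall>\<^sub>F n in sequentially. \<mu> n \<le> c * real n"
    and mu_large: "\<And>C :: nat. \<forall>\<^sub>F n in sequentially. real (C * gr E0 n) \<le> exp (\<mu> n)"
    and E0_small: "\<And>C :: nat. \<forall>\<^sub>F n in sequentially. real (C * gr E0 n) < exp (real n powr (4 / 5))"
begin

lemma exists_successor:
  assumes "admissible \<mu> (E, n)"
  shows "\<exists>E' n'. admissible \<mu> (E', n') \<and> successor \<mu> (E, n) (E', n')"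
proof -
  obtain C where E: "gcong E" "E \<le> E0" and C: "\<And>m. gr E m \<le> C * gr E0 m"
    and En: "\<And>m. n \<le> m \<Longrightarrow> gr E m \<le> 2 * exp (\<mu> m)"
    using assms by (auto simp: admissible_def)
  \<comment> \<open>The growth of \<open>E\<close> is within a constant factor of that of
    Grigorchuk's group, so it is eventually slow.\<close>
  have "\<forall>\<^sub>F r in sequentially. r \<ge> Suc n \<and> real (C * gr E0 r) < exp (real r powr (4 / 5)) \<and>
      (\<forall>m\<ge>r. real (C * gr E0 m) \<le> exp (\<mu> m))"
    using E0_small[of C] mu_large[of C]
    by (intro eventually_conj eventually_ge_at_top eventually_all_ge_at_top)
  then obtain r where r: "Suc n \<le> r" "real (C * gr E0 r) < exp (real r powr (4 / 5))"
    "\<And>m. r \<le> m \<Longrightarrow> real (C * gr E0 m) \<le> exp (\<mu> m)"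
    using eventually_happens'[OF sequentially_bot] by blast
  have Ebound: "gr E m \<le> exp (\<mu> m)" if "r \<le> m" for m
  proof -
    have "real (gr E m) \<le> real (C * gr E0 m)" using C by (simp only: of_nat_le_iff)
    then show ?thesis using r(3)[OF that] by simp
  qed
  obtain k where k: "\<And>u v. length u \<le> r \<Longrightarrow> length v \<le> r \<Longrightarrow> E0 u v \<Longrightarrow> (Phi ^^ k) T0 u v"
    using E0_ball by blast
  \<comment> \<open>Lifting through \<open>k\<close> levels costs \<open>3 ^ k\<close>, and setting
    \<open>m\<close> lamps takes words of length up to \<open>3 * m\<close>.\<close>
  define d :: nat where "d = 3 ^ Suc k"
  have d: "d > 0" by (simp add: d_def)
  \<comment> \<open>At this rate \<open>exp (\<mu> (d * m))\<close> is at most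
    \<open>2 powr (m / 2)\<close>, below the \<open>2 ^ m\<close> elements found at radius
    \<open>d * m\<close>.\<close>
  have "\<forall>\<^sub>F m in sequentially. m \<ge> Suc r \<and> \<mu> m \<le> ln 2 / (2 * d) * real m"
    using mu_sublinear[of "ln 2 / (2 * d)"] d
    by (intro eventually_conj eventually_ge_at_top) simp
  then obtain m0 where m0: "\<And>m. m \<ge> m0 \<Longrightarrow> m \<ge> Suc r \<and> \<mu> m \<le> ln 2 / (2 * d) * real m"
    by (auto simp: eventually_sequentially)
  define m where "m = max 1 m0"
  have "m \<ge> 1" "m \<ge> m0" by (simp_all add: m_def)
  moreover have "m \<le> d * m" using d by simp
  ultimately have m: "m \<ge> 1" "d * m \<ge> m0" by linarith+
  define N where "N = (Phi ^^ k) (Lam (2 ^ m))"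
  have N: "gcong N" "towered N"
    unfolding N_def by (simp_all add: Phi_pow_gcong Lam_gcong towered_Phi_pow Lam_towered)
  have "int m \<le> 2 ^ m" by (metis of_nat_le_iff of_nat_power of_nat_numeral less_exp less_imp_le)
  then have "2 ^ m \<le> gr (Lam (2 ^ m)) (3 * m)" by (rule gr_Lam)
  also have "\<dots> \<le> gr N (3 ^ k * (3 * m))" unfolding N_def by (rule gr_Phi_pow[OF Lam_gcong])
  also have "\<dots> = gr N (d * m)" by (simp add: d_def mult_ac)
  also have "\<dots> \<le> gr (inf E N) (d * m)" by (rule gr_antimono[OF N(1) gcong_inf[OF E(1) N(1)]]) simp
  finally have big: "2 ^ m \<le> gr (inf E N) (d * m)" .
  have "exp (\<mu> (d * m)) \<le> exp (ln 2 / 2 * m)"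
    using m0[OF m(2)] d by (simp add: field_simps)
  also have "\<dots> < exp (m * ln 2)" using m(1) by simp
  also have "\<dots> = real (2 ^ m)" by (simp add: exp_of_nat_mult)
  also have "\<dots> \<le> gr (inf E N) (d * m)" using big by (simp only: of_nat_le_iff)
  finally have bigR: "exp (\<mu> (d * m)) < gr (inf E N) (d * m)" .
  define bad where "bad T \<longleftrightarrow> (\<exists>m\<ge>r. exp (\<mu> m) < gr T m)" for T :: wrel
  have "bad (inf E N)" unfolding bad_def using bigR m0[OF m(2)] by (intro exI[of _ "d * m"]) auto
  moreover have "\<not> bad E" unfolding bad_def using Ebound by (auto simp: not_less)
  ultimately obtain T T' where T: "gcong T" "gcong T'" "inf E N \<le> T" "T \<le> E" "bad T" "\<not> bad T'"
    "\<And>n. gr T n \<le> 2 * gr T' n"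
    using interpolate[OF E(1) N, of bad] by metis
  obtain n' where n': "n' \<ge> r" "exp (\<mu> n') < gr T n'" using T(5) by (auto simp: bad_def)
  \<comment> \<open>Replacing \<open>T0\<close> by the lamplighter congruence at depth
    \<open>k\<close> only adds relations, so on this ball every relation of \<open>E\<close> holds
    modulo \<open>N\<close>.\<close>
  have ET: "T u v" if "length u \<le> r" "length v \<le> r" "E u v" for u v
  proof -
    have "(Phi ^^ k) T0 u v" using k that E(2) by auto
    then have "N u v" unfolding N_def using Phi_pow_mono[OF T0_least[OF Lam_gcong]] by blast
    then show ?thesis using that(3) T(3) by (auto simp: le_fun_def)
  qed
  have grTE: "gr T m = gr E m" if "m \<le> r" for m
    using ET T(4) that by (intro gr_cong T(1) E(1)) (auto simp: le_fun_def)
  \<comment> \<open>Up to \<open>r\<close> the bound is inherited from \<open>E\<close>; beyond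
    \<open>r\<close>, \<open>T\<close> exceeds the good \<open>T'\<close> by a factor of at most
    2.\<close>
  have Tbound: "gr T m \<le> 2 * exp (\<mu> m)" if "n \<le> m" for m
  proof (cases "m \<le> r")
    case True
    then show ?thesis using grTE En[OF that] by simp
  next
    case False
    have "real (gr T m) \<le> real (2 * gr T' m)" using T(7) by (simp only: of_nat_le_iff)
    moreover have "gr T' m \<le> exp (\<mu> m)" using T(6) False by (auto simp: bad_def not_less)
    ultimately show ?thesis by simp
  qed
  obtain X :: "gen list set" and F where X: "finite X" "range F \<subseteq> X" "\<And>u v. F u = F v \<Longrightarrow> N u v"
    using towered_finite_index[OF N] by blast
  have "gr T m \<le> (card X * C) * gr E0 m" for m
  proof -
    have "gr T m \<le> card X * gr E m"
      using T(3) X(3) by (intro gr_finite_index[OF T(1) E(1) X(1,2)]) (auto simp: le_fun_def)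
    also have "\<dots> \<le> card X * (C * gr E0 m)" by (intro mult_left_mono C) simp
    finally show ?thesis by (simp add: mult.assoc)
  qed
  moreover have "T \<le> E0" using T(4) E(2) by (rule order_trans)
  ultimately have "admissible \<mu> (T, n')"
    unfolding admissible_def using T(1) Tbound n'(1) r(1) by auto
  moreover have "gr T r < exp (real r powr (4 / 5))"
  proof -
    have "real (gr T r) \<le> real (C * gr E0 r)" using grTE[of r] C[of r] by (simp only: of_nat_le_iff)
    then show ?thesis using r(2) by simp
  qed
  ultimately show ?thesis
    unfolding successor_def using T(4) n' r(1) ET Tbound
    by (intro exI[of _ T] exI[of _ n']) (auto intro!: exI[of _ r])
qed

text \<open>Intersect a chain of successors: the \<open>i\<close>-th congruence is final on the ball
  of radius \<open>l i\<close>, so the growth of the limit is read off stage by stage.\<close>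

lemma oscillating_congruence:
  obtains R where "gcong R" "infinite {n. gr R n < exp (real n powr (4 / 5))}"
    "infinite {n. exp (\<mu> n) < gr R n}" "\<forall>\<^sub>F n in sequentially. gr R n \<le> 2 * exp (\<mu> n)"
proof -
  obtain n0 where n0: "\<And>m. m \<ge> n0 \<Longrightarrow> real (1 * gr E0 m) \<le> exp (\<mu> m)"
    using mu_large[of 1] by (auto simp: eventually_sequentially)
  have "gr E0 m \<le> 2 * exp (\<mu> m)" if "m \<ge> n0" for m
    using n0[OF that] exp_gt_zero[of "\<mu> m"] by simp
  then have "admissible \<mu> (E0, n0)"
    unfolding admissible_def by (auto simp: E0_gcong intro!: exI[of _ 1])
  then have "\<exists>s. \<forall>i. admissible \<mu> (s i) \<and> successor \<mu> (s i) (s (Suc i))"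
    using exists_successor by (intro dependent_nat_choice) auto
  then obtain s where adm: "\<And>i. admissible \<mu> (s i)" and suc: "\<And>i. successor \<mu> (s i) (s (Suc i))"
    by blast
  define e where "e i = fst (s i)" for i
  define l where "l i = snd (s i)" for i
  have s: "s i = (e i, l i)" for i by (simp add: e_def l_def)
  have e: "gcong (e i)" for i using adm[of i] by (simp add: admissible_def s)
  note S = suc[unfolded successor_def s prod.case]
  have l_mono: "strict_mono l" using S by (simp add: strict_mono_Suc_iff)
  have e_anti: "e j \<le> e i" if "i \<le> j" for i j
    by (rule lift_Suc_antimono_le[OF _ that]) (use S in blast)
  have agree: "e (i + j) u v" if "length u \<le> l i" "length v \<le> l i" "e i u v" for i j u v
  proof (induction j)
    case (Suc j)
    have "l i \<le> l (i + j)" using l_mono by (simp add: strict_mono_less_eq)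
    then have "length u \<le> l (i + j)" "length v \<le> l (i + j)" using that by auto
    then show ?case using S[of "i + j"] Suc by simp
  qed (use that in simp)
  define R :: wrel where "R u v \<longleftrightarrow> (\<forall>i. e i u v)" for u v
  have R: "gcong R"
  proof (rule gcongI)
    show "R u w" if "R u v" "R v w" for u v w
      using that gcong_trans[OF e] unfolding R_def by blast
    show "R v u" if "R u v" for u v using that gcong_sym[OF e] unfolding R_def by blast
  qed (auto simp: R_def e gcong_refl gcong_append gcong_sq gcong_BC)
  have grR: "gr R m = gr (e i) m" if "m \<le> l i" for m i
  proof (rule gr_cong[OF R e])
    fix u v :: "gen list" assume len: "length u \<le> m" "length v \<le> m"
    have "e j u v" if uv: "e i u v" for j
    proof (cases "i \<le> j")
      case True
      then show ?thesis using agree[of u i v "j - i"] len \<open>m \<le> l i\<close> uv by auto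
    next
      case False
      then show ?thesis using e_anti[of j i] uv by auto
    qed
    then show "R u v = e i u v" by (auto simp: R_def)
  qed
  have unb: "i \<le> l i" for i using l_mono by (rule strict_mono_imp_increasing)
  have "\<exists>n\<ge>i. gr R n < exp (real n powr (4 / 5))" for i
  proof -
    obtain r where r: "l i \<le> r" "r \<le> l (Suc i)" "gr (e (Suc i)) r < exp (real r powr (4 / 5))"
      using S[of i] by blast
    then show ?thesis using grR[of r "Suc i"] unb[of i] by (intro exI[of _ r]) auto
  qed
  then have inf1: "infinite {n. gr R n < exp (real n powr (4 / 5))}"
    by (auto simp: infinite_nat_iff_unbounded_le)
  have "\<exists>n\<ge>i. exp (\<mu> n) < gr R n" for i
    using S[of i] grR[of "l (Suc i)" "Suc i"] unb[of "Suc i"] by (intro exI[of _ "l (Suc i)"]) auto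
  then have inf2: "infinite {n. exp (\<mu> n) < gr R n}"
    by (auto simp: infinite_nat_iff_unbounded_le)
  have "gr R m \<le> 2 * exp (\<mu> m)" if m: "m \<ge> l 0" for m
  proof -
    \<comment> \<open>Then \<open>l i \<le> m \<le> l (Suc i)\<close>: stage \<open>Suc i\<close> is
      final at \<open>m\<close>, and its bound already holds from \<open>l i\<close> on.\<close>
    define i where "i = (GREATEST i. l i \<le> m)"
    have bd: "\<forall>i. l i \<le> m \<longrightarrow> i \<le> m" using unb order_trans by blast
    have i: "l i \<le> m"
      unfolding i_def by (rule GreatestI_nat[where P = "\<lambda>i. l i \<le> m", OF m]) (use bd in blast)
    have "Suc i \<le> i" if "l (Suc i) \<le> m"
      unfolding i_def
      by (rule Greatest_le_nat[where P = "\<lambda>i. l i \<le> m", OF that[unfolded i_def]]) (use bd in blast)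
    then have "m \<le> l (Suc i)" by (cases "m \<le> l (Suc i)") auto
    then have "gr R m = gr (e (Suc i)) m" by (rule grR)
    then show ?thesis using S[of i] i by simp
  qed
  then have "\<forall>\<^sub>F m in sequentially. gr R m \<le> 2 * exp (\<mu> m)"
    by (auto simp: eventually_sequentially)
  then show ?thesis using that R inf1 inf2 by blast
qed

end

subsection \<open>Subexponential growth\<close>

text \<open>Bernoulli's inequality: a concave power lies below its tangent at 1.\<close>

lemma powr_le_affine:
  fixes t a :: real
  assumes "t > 0" "0 \<le> a" "a \<le> 1"
  shows "t powr a \<le> 1 + a * (t - 1)"
proof -
  \<comment> \<open>The weights make the logarithmic terms cancel.\<close>
  have "1 = a * (1 + (1 - a) * ln t) + (1 - a) * (1 + (- a) * ln t)" by (simp add: algebra_simps)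
  also have "\<dots> \<le> a * exp ((1 - a) * ln t) + (1 - a) * exp ((- a) * ln t)"
    using assms by (intro add_mono mult_left_mono exp_ge_add_one_self) auto
  also have "\<dots> = a * t powr (1 - a) + (1 - a) * t powr (- a)" using assms by (simp add: powr_def)
  finally have "1 * t powr a \<le> (a * t powr (1 - a) + (1 - a) * t powr (- a)) * t powr a"
    by (intro mult_right_mono) auto
  also have "\<dots> = a * (t powr (1 - a) * t powr a) + (1 - a) * (t powr (- a) * t powr a)"
    by (simp add: algebra_simps)
  also have "\<dots> = 1 + a * (t - 1)"
    using assms by (simp add: powr_add[symmetric] algebra_simps)
  finally show ?thesis by simp
qed

text \<open>Concavity: add the tangent bounds at the mean.\<close>

lemma powr_add_le:
  fixes x y a :: real
  assumes "x > 0" "y > 0" "0 \<le> a" "a \<le> 1"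
  shows "x powr a + y powr a \<le> 2 * ((x + y) / 2) powr a"
proof -
  define m where "m = (x + y) / 2"
  have m: "m > 0" using assms by (simp add: m_def)
  have le: "t powr a \<le> m powr a * (1 + a * (t / m - 1))" if t: "t > 0" for t
  proof -
    have "t powr a = m powr a * (t / m) powr a" using t m by (simp add: powr_divide)
    then show ?thesis using powr_le_affine[of "t / m" a] assms t m by (simp add: mult_left_mono)
  qed
  have "x powr a + y powr a \<le> m powr a * (2 + a * ((x + y) / m - 2))"
    using le[OF assms(1)] le[OF assms(2)] by (simp add: algebra_simps add_divide_distrib)
  also have "(x + y) / m = 2" using m by (simp add: m_def field_simps)
  finally show ?thesis by (simp add: m_def mult.commute)
qed

text \<open>The exponent 159/200 lies strictly between ln 2 / ln (12/5) and 4/5.\<close>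

lemma contraction_exponent: "2 * (5 / 12) powr (159 / 200 :: real) < 1"
proof -
  \<comment> \<open>The 200th power leaves a comparison of rational numbers.\<close>
  have "((5 / 12) powr (159 / 200 :: real)) ^ 200 = (5 / 12) powr (real 200 * (159 / 200))"
    by (rule powr_power) simp
  also have "real 200 * (159 / 200) = 159" by simp
  also have "(5 / 12 :: real) powr 159 = (5 / 12) ^ 159" by (rule powr_numeral) simp
  also have "\<dots> < (1 / 2) ^ 200" by (simp add: power_divide)
  finally have "(5 / 12) powr (159 / 200 :: real) < 1 / 2" by (rule power_less_imp_less_base) simp
  then show ?thesis by simp
qed

text \<open>By concavity the even split is the worst. It multiplies the bound by about
  \<open>2 * (5 / 12) powr a\<close>, which is below 1, and the slack absorbs the logarithm of the
  number of terms.\<close>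

lemma subexponential_recursion:
  fixes g :: "nat \<Rightarrow> nat" and a :: real
  assumes a: "0 < a" "a \<le> 1" "2 * (5 / 12) powr a < 1"
    and pos: "\<And>n. g n > 0"
    and rec: "\<And>n. g n \<le> 2 * (\<Sum>i\<le>5 * (n + 7) div 6. g i * g (5 * (n + 7) div 6 - i))"
  shows "\<exists>K. \<forall>n. ln (g n) \<le> K * (real n + 1) powr a"
proof -
  define \<theta> where "\<theta> = 2 * (5 / 12) powr a"
  define \<epsilon> where "\<epsilon> = (1 - \<theta>) / 2"
  have \<epsilon>: "\<epsilon> > 0" "\<theta> < 1 - \<epsilon>" using a(3)[folded \<theta>_def] by (simp_all add: \<epsilon>_def field_simps)
  let ?h = "\<lambda>n. ((5 * (real n + 7) / 6 + 2) / 2) / (real n + 1)"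
  have h: "(?h \<longlongrightarrow> 5 / 12) sequentially" by real_asymp
  have "((\<lambda>n. 2 * ?h n powr a) \<longlongrightarrow> \<theta>) sequentially"
    unfolding \<theta>_def by (intro tendsto_mult tendsto_powr tendsto_const h) auto
  then have ev1: "\<forall>\<^sub>F n in sequentially. 2 * ?h n powr a < 1 - \<epsilon>"
    using \<epsilon>(2) by (rule order_tendstoD(2))
  have "((\<lambda>n. ln (2 * (5 * (real n + 7) / 6 + 1)) / (real n + 1) powr a) \<longlongrightarrow> 0) sequentially"
    using a(1) by real_asymp
  then have ev2: "\<forall>\<^sub>F n in sequentially. ln (2 * (5 * (real n + 7) / 6 + 1)) / (real n + 1) powr a < \<epsilon>"
    using \<epsilon>(1) by (rule order_tendstoD(2))
  \<comment> \<open>From 36 on, \<open>5 * (n + 7) / 6 < n\<close>, so the induction hypothesis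
    applies.\<close>
  have "\<forall>\<^sub>F n in sequentially. n \<ge> 36 \<and> 2 * ?h n powr a < 1 - \<epsilon> \<and>
      ln (2 * (5 * (real n + 7) / 6 + 1)) / (real n + 1) powr a < \<epsilon>"
    using ev1 ev2 by (intro eventually_conj eventually_ge_at_top)
  then obtain n0 where n0: "\<And>n. n \<ge> n0 \<Longrightarrow> n \<ge> 36" "\<And>n. n \<ge> n0 \<Longrightarrow> 2 * ?h n powr a < 1 - \<epsilon>"
    "\<And>n. n \<ge> n0 \<Longrightarrow> ln (2 * (5 * (real n + 7) / 6 + 1)) / (real n + 1) powr a < \<epsilon>"
    by (auto simp: eventually_sequentially)
  \<comment> \<open>Covers the initial values; \<open>K \<ge> 1\<close> lets the logarithmic term be
    absorbed.\<close>
  define K where "K = 1 + (\<Sum>n<n0. ln (g n))"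
  have ln_nonneg: "ln (real (g n)) \<ge> 0" for n using pos[of n] by (simp add: Suc_leI)
  have K: "K \<ge> 1" unfolding K_def using ln_nonneg by (simp add: sum_nonneg)
  have "ln (g n) \<le> K * (real n + 1) powr a" for n
  proof (induction n rule: less_induct)
    case (less n)
    show ?case
    proof (cases "n < n0")
      case True
      have "ln (g n) \<le> (\<Sum>n<n0. ln (g n))"
        using True ln_nonneg by (intro member_le_sum) auto
      then have "ln (g n) \<le> K * 1" by (simp add: K_def)
      also have "\<dots> \<le> K * (real n + 1) powr a"
        using K a(1) by (intro mult_left_mono ge_one_powr_ge_zero) auto
      finally show ?thesis .
    next
      case False
      then have n: "n \<ge> n0" by simp
      have cancel: "x = x / (real n + 1) * (real n + 1)" for x :: real by simp
      define N where "N = 5 * (n + 7) div 6"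
      have Nn: "N < n" using n0(1)[OF n] by (simp add: N_def)
      have "6 * N \<le> 5 * (n + 7)" unfolding N_def by simp
      then have "real (6 * N) \<le> real (5 * (n + 7))" by (simp only: of_nat_le_iff)
      then have N: "real N \<le> 5 * (real n + 7) / 6" by simp
      define B where "B = K * (2 * ((real N + 2) / 2) powr a)"
      have gB: "real (g i * g (N - i)) \<le> exp B" if i: "i \<le> N" for i
      proof -
        have "ln (real (g i * g (N - i))) = ln (g i) + ln (g (N - i))"
          using pos by (simp add: ln_mult)
        also have "\<dots> \<le> K * (real i + 1) powr a + K * (real (N - i) + 1) powr a"
          using i Nn by (intro add_mono less.IH) auto
        also have "\<dots> = K * ((real i + 1) powr a + (real (N - i) + 1) powr a)"
          by (simp add: algebra_simps)
        also have "\<dots> \<le> K * (2 * (((real i + 1) + (real (N - i) + 1)) / 2) powr a)"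
          using K a by (intro mult_left_mono powr_add_le) auto
        also have "(real i + 1) + (real (N - i) + 1) = real N + 2" using i by simp
        finally have "ln (real (g i * g (N - i))) \<le> B" by (simp only: B_def)
        then have "exp (ln (real (g i * g (N - i)))) \<le> exp B" by (simp only: exp_le_cancel_iff)
        moreover have "real (g i * g (N - i)) > 0" using pos by simp
        ultimately show ?thesis by (simp only: exp_ln)
      qed
      have "real (g n) \<le> real (2 * (\<Sum>i\<le>N. g i * g (N - i)))"
        using rec[of n] unfolding N_def by (simp only: of_nat_le_iff)
      also have "\<dots> = 2 * (\<Sum>i\<le>N. real (g i * g (N - i)))" by simp
      also have "\<dots> \<le> 2 * (\<Sum>i\<le>N. exp B)" by (intro mult_left_mono sum_mono gB) auto
      also have "\<dots> = 2 * (real N + 1) * exp B" by simp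
      finally have "ln (g n) \<le> ln (2 * (real N + 1) * exp B)"
        using pos[of n] by (subst ln_le_cancel_iff) auto
      also have "\<dots> = ln (2 * (real N + 1)) + B" by (simp add: ln_mult)
      also have "ln (2 * (real N + 1)) \<le> ln (2 * (5 * (real n + 7) / 6 + 1))"
        using N by (intro ln_mono) simp_all
      also have "B \<le> K * (2 * ((5 * (real n + 7) / 6 + 2) / 2) powr a)"
        unfolding B_def using N K a(1) by (intro mult_left_mono powr_mono2) simp_all
      also have "ln (2 * (5 * (real n + 7) / 6 + 1)) \<le> \<epsilon> * (real n + 1) powr a"
        using n0(3)[OF n] by (simp add: divide_less_eq)
      also have "\<epsilon> * (real n + 1) powr a \<le> K * (\<epsilon> * (real n + 1) powr a)"
        using mult_right_mono[OF K, of "\<epsilon> * (real n + 1) powr a"] \<epsilon>(1) by simp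
      also have "(5 * (real n + 7) / 6 + 2) / 2 = ?h n * (real n + 1)" by (rule cancel)
      also have "(?h n * (real n + 1)) powr a = ?h n powr a * (real n + 1) powr a"
        by (rule powr_mult; simp)
      also have "K * (\<epsilon> * (real n + 1) powr a) + K * (2 * (?h n powr a * (real n + 1) powr a)) =
          K * ((\<epsilon> + 2 * ?h n powr a) * (real n + 1) powr a)"
        by (simp add: algebra_simps)
      also have "\<dots> \<le> K * (1 * (real n + 1) powr a)"
        using n0(2)[OF n] K by (intro mult_left_mono mult_right_mono) auto
      finally show ?thesis by simp
    qed
  qed
  then show ?thesis by blast
qed

section \<open>Growth of Grigorchuk's group\<close>

lemma gr_E0_bound: "\<exists>K. \<forall>n. ln (gr E0 n) \<le> K * (real (8 * n) + 1) powr (159 / 200)"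
proof -
  obtain K where K: "\<And>n. ln (G0 n) \<le> K * (real n + 1) powr (159 / 200)"
    using subexponential_recursion[OF _ _ contraction_exponent G0_pos G0_rec] by auto
  have "ln (real (gr E0 n)) \<le> ln (real (G0 (8 * n)))" for n
    using gr_E0_le[of n] gr_pos[of E0 n] by (subst ln_le_cancel_iff) auto
  then show ?thesis using K order_trans by blast
qed

lemma gr_E0_eventually_small:
  assumes "\<And>K c. \<forall>\<^sub>F n in sequentially. c + K * (real (8 * n) + 1) powr (159 / 200) < f n"
  shows "\<forall>\<^sub>F n in sequentially. real (M * gr E0 n) < exp (f n)"
proof -
  obtain K where K: "\<And>n. ln (gr E0 n) \<le> K * (real (8 * n) + 1) powr (159 / 200)"
    using gr_E0_bound by blast
  show ?thesis
  proof (cases "M = 0")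
    case False
    show ?thesis using assms[of "ln M" K]
    proof eventually_elim
      case (elim n)
      then have "ln M + ln (gr E0 n) < f n" using K[of n] by linarith
      then have "exp (ln M + ln (gr E0 n)) < exp (f n)" by simp
      then show ?case using False gr_pos[of E0 n] by (simp add: exp_add)
    qed
  qed simp
qed

theorem corollary1p2:
  fixes \<alpha> \<beta> :: real and \<mu> :: "nat \<Rightarrow> real"
  assumes \<mu>: "\<mu> = (\<lambda>n. real n powr \<alpha> * ln (real n) powr \<beta>)"
    and exponents: "(5 / 6 < \<alpha> \<and> \<alpha> < 1) \<or> (\<alpha> = 1 \<and> \<beta> < 0)"
  shows "\<exists>(\<Gamma> :: nat monoid) S.
           group \<Gamma> \<and> finite_symmetric_generating_set \<Gamma> S \<and>
           infinite {n. real (growth \<Gamma> S n) < exp (real n powr (4 / 5))} \<and>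
           infinite {n'. real (growth \<Gamma> S n') > exp (\<mu> n')} \<and>
           (\<forall>\<^sub>F m in sequentially. real (growth \<Gamma> S m) < exp (\<mu> (9 * m)))"
proof -
  have sublin: "\<forall>\<^sub>F n in sequentially. \<mu> n \<le> c * real n" if "c > 0" for c
  proof -
    have "((\<lambda>n. \<mu> n / real n) \<longlongrightarrow> 0) sequentially"
      using exponents
    proof
      assume "5 / 6 < \<alpha> \<and> \<alpha> < 1"
      then show ?thesis unfolding \<mu> by real_asymp
    next
      assume "\<alpha> = 1 \<and> \<beta> < 0"
      then show ?thesis unfolding \<mu> by real_asymp
    qed
    then have "\<forall>\<^sub>F n in sequentially. \<mu> n / real n < c" using \<open>c > 0\<close> by (rule order_tendstoD(2))
    then show ?thesis using eventually_gt_at_top[of 0]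
      by eventually_elim (simp add: divide_less_eq)
  qed
  \<comment> \<open>The exponent \<alpha> exceeds 159/200, so neither the constants nor \<beta>
    matter.\<close>
  have large: "\<forall>\<^sub>F n in sequentially. c + K * (real (8 * n) + 1) powr (159 / 200) < \<mu> n" for K c
    using exponents
  proof
    assume "5 / 6 < \<alpha> \<and> \<alpha> < 1"
    then show ?thesis unfolding \<mu> by real_asymp
  next
    assume "\<alpha> = 1 \<and> \<beta> < 0"
    then show ?thesis unfolding \<mu> by real_asymp
  qed
  have small: "\<forall>\<^sub>F n in sequentially. c + K * (real (8 * n) + 1) powr (159 / 200) < real n powr (4 / 5)"
    for K c by real_asymp
  \<comment> \<open>The ratio of \<open>\<mu> (9 * n)\<close> to \<open>\<mu> n\<close> tends to
    \<open>9 powr \<alpha> > 1\<close> and \<open>\<mu>\<close> is unbounded, so the dilation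
    absorbs the factor 2.\<close>
  have gap: "\<forall>\<^sub>F n in sequentially. ln 2 + \<mu> n < \<mu> (9 * n)"
    using exponents
  proof
    assume "5 / 6 < \<alpha> \<and> \<alpha> < 1"
    then show ?thesis unfolding \<mu> by real_asymp
  next
    assume "\<alpha> = 1 \<and> \<beta> < 0"
    then show ?thesis unfolding \<mu> by real_asymp
  qed
  have "\<forall>\<^sub>F n in sequentially. real (C * gr E0 n) \<le> exp (\<mu> n)" for C
    using gr_E0_eventually_small[OF large, of C] by eventually_elim simp
  then obtain R where R: "gcong R" "infinite {n. gr R n < exp (real n powr (4 / 5))}"
    "infinite {n. exp (\<mu> n) < gr R n}" "\<forall>\<^sub>F n in sequentially. gr R n \<le> 2 * exp (\<mu> n)"
    using oscillating_congruence[of \<mu>, OF sublin _ gr_E0_eventually_small[OF small]] by blast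
  have "\<forall>\<^sub>F m in sequentially. gr R m < exp (\<mu> (9 * m))"
    using R(4) gap
  proof eventually_elim
    case (elim m)
    have "2 * exp (\<mu> m) = exp (ln 2 + \<mu> m)" by (simp add: exp_add)
    also have "\<dots> < exp (\<mu> (9 * m))" using elim(2) by simp
    finally show ?case using elim(1) by simp
  qed
  then show ?thesis
    using R wgrp_group wgrp_generating by (intro exI[of _ "wgrp R"] exI[of _ "letters R"]) (simp add: growth_wgrp)
qed

end
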